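(* Let $S$ be a finite inverse semigroup. Then the Booleanization of $S$ is (isomorphic to) $\mathsf{K}(\mathcal{G}(S))$, the Boolean inverse monoid of all local bisections of the restricted groupoid $\mathcal{G}(S)$ of $S$.
   Context: For an inverse semigroup $S$, $\mathsf{E}(S)$ is its set of idempotents, $\mathbf{d}(a)=a^{-1}a$ and $\mathbf{r}(a)=aa^{-1}$. The natural partial order is $a\le b$ iff $a=ba^{-1}a$; joins and meets refer to it. Elements $a,b$ are compatible, $a\sim b$, if $a^{-1}b$ and $ab^{-1}$ are both idempotents. A Boolean algebra here means a generalized Boolean algebra: a distributive lattice with bottom (a top is not required) in which every principal order-ideal is a (unital) Boolean algebra. An inverse semigroup with zero is distributive if any two compatible elements have a join and multiplication distributes on both sides over such joins; it is Boolean if in addition $(\mathsf{E}(S),\le)$ is a Boolean algebra. A morphism of Boolean inverse semigroups is a semigroup homomorphism that maps zero to zero and preserves binary compatible joins. Homomorphisms between inverse semigroups with zero are required to preserve zero. Booleanization: if $S$ is an inverse semigroup with zero, its Booleanization is a Boolean inverse semigroup $\mathsf{B}(S)$ with a homomorphism $\beta\colon S\to\mathsf{B}(S)$ such that for every homomorphism $\alpha\colon S\to T$ to a Boolean inverse semigroup $T$ there is a unique morphism of Boolean inverse semigroups $\gamma\colon\mathsf{B}(S)\to T$ with $\gamma\beta=\alpha$. If $S$ has no zero, its Booleanization is that of $S^{0}$, the semigroup $S$ with a zero adjoined. The restricted product $a\cdot b$ is defined exactly when $\mathbf{d}(a)=\mathbf{r}(b)$, and then equals $ab$. The restricted groupoid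 $\mathcal{G}(S)$ is the groupoid with underlying set $S$ (if $S$ has no zero) or $S\setminus\{0\}$ (if $S$ has a zero) under the restricted product. A subset $A$ of a groupoid $G$ is a local bisection if for $a,b\in A$, $\mathbf{d}(a)=\mathbf{d}(b)$ implies $a=b$ and $\mathbf{r}(a)=\mathbf{r}(b)$ implies $a=b$, where $\mathbf{d}(x)=x^{-1}x$ and $\mathbf{r}(x)=xx^{-1}$ (the empty set is a local bisection). $\mathsf{K}(G)$ is the set of all local bisections with multiplication $AB=\{ab: a\in A, b\in B, \mathbf{d}(a)=\mathbf{r}(b)\}$. *)

theory Defs
  imports "HOL-Algebra.Group"
begin

section \<open>Inverse semigroups\<close>

text \<open>
  Semigroups are carried by the library record \<^type>\<open>monoid\<close>, whose homomorphisms and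
  isomorphisms (\<^const>\<open>hom\<close>, \<^const>\<open>is_iso\<close>) only involve the carrier and the multiplication.
  The field \<^const>\<open>one\<close> is never referred to, except in the claim that a particular
  structure is a \<^const>\<open>monoid\<close>; for all other structures it is junk.
\<close>

locale inverse_semigroup =
  fixes S (structure)
  assumes m_closed: "\<lbrakk>a \<in> carrier S; b \<in> carrier S\<rbrakk> \<Longrightarrow> a \<otimes> b \<in> carrier S"
    and m_assoc: "\<lbrakk>a \<in> carrier S; b \<in> carrier S; c \<in> carrier S\<rbrakk>
      \<Longrightarrow> (a \<otimes> b) \<otimes> c = a \<otimes> (b \<otimes> c)"
    and unique_inverse: "a \<in> carrier S
      \<Longrightarrow> \<exists>!b. b \<in> carrier S \<and> a \<otimes> b \<otimes> a = a \<and> b \<otimes> a \<otimes> b = b"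

definition sinv :: "('a, 'm) monoid_scheme \<Rightarrow> 'a \<Rightarrow> 'a" where
  "sinv S a = (THE b. b \<in> carrier S \<and> a \<otimes>\<^bsub>S\<^esub> b \<otimes>\<^bsub>S\<^esub> a = a \<and> b \<otimes>\<^bsub>S\<^esub> a \<otimes>\<^bsub>S\<^esub> b = b)"

definition sdom :: "('a, 'm) monoid_scheme \<Rightarrow> 'a \<Rightarrow> 'a" where
  "sdom S a = sinv S a \<otimes>\<^bsub>S\<^esub> a"

definition sran :: "('a, 'm) monoid_scheme \<Rightarrow> 'a \<Rightarrow> 'a" where
  "sran S a = a \<otimes>\<^bsub>S\<^esub> sinv S a"

definition idempotents :: "('a, 'm) monoid_scheme \<Rightarrow> 'a set" where
  "idempotents S = {e \<in> carrier S. e \<otimes>\<^bsub>S\<^esub> e = e}"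

definition natural_order :: "('a, 'm) monoid_scheme \<Rightarrow> 'a gorder" where
  "natural_order S =
    \<lparr>carrier = carrier S, eq = (=), le = (\<lambda>a b. a = b \<otimes>\<^bsub>S\<^esub> sinv S a \<otimes>\<^bsub>S\<^esub> a)\<rparr>"

definition compatible :: "('a, 'm) monoid_scheme \<Rightarrow> 'a \<Rightarrow> 'a \<Rightarrow> bool" where
  "compatible S a b \<longleftrightarrow>
    sinv S a \<otimes>\<^bsub>S\<^esub> b \<in> idempotents S \<and> a \<otimes>\<^bsub>S\<^esub> sinv S b \<in> idempotents S"

abbreviation is_join :: "('a, 'm) monoid_scheme \<Rightarrow> 'a \<Rightarrow> 'a \<Rightarrow> 'a \<Rightarrow> bool" where
  "is_join S j a b \<equiv> is_lub (natural_order S) j {a, b}"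

definition is_zero :: "('a, 'm) monoid_scheme \<Rightarrow> 'a \<Rightarrow> bool" where
  "is_zero S z \<longleftrightarrow> z \<in> carrier S \<and> (\<forall>s\<in>carrier S. z \<otimes>\<^bsub>S\<^esub> s = z \<and> s \<otimes>\<^bsub>S\<^esub> z = z)"

definition has_zero :: "('a, 'm) monoid_scheme \<Rightarrow> bool" where
  "has_zero S \<longleftrightarrow> (\<exists>z. is_zero S z)"

definition adjoin_zero :: "('a, 'm) monoid_scheme \<Rightarrow> 'a option monoid" where
  "adjoin_zero S =
    \<lparr>carrier = insert None (Some ` carrier S),
     mult = (\<lambda>x y. case (x, y) of (Some a, Some b) \<Rightarrow> Some (a \<otimes>\<^bsub>S\<^esub> b) | _ \<Rightarrow> None),
     one = Some \<one>\<^bsub>S\<^esub>\<rparr>"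

text \<open>Homomorphisms between inverse semigroups with zero; zeros are unique if they exist.\<close>

definition zero_hom :: "('a, 'm) monoid_scheme \<Rightarrow> ('b, 'n) monoid_scheme \<Rightarrow> ('a \<Rightarrow> 'b) set" where
  "zero_hom S T = {h \<in> hom S T. \<forall>z. is_zero S z \<longrightarrow> is_zero T (h z)}"


section \<open>Boolean inverse semigroups\<close>

locale distributive_lattice = lattice L for L (structure) +
  assumes meet_join_distrib: "\<lbrakk>x \<in> carrier L; y \<in> carrier L; z \<in> carrier L\<rbrakk>
    \<Longrightarrow> x \<sqinter> (y \<squnion> z) = (x \<sqinter> y) \<squnion> (x \<sqinter> z)"

locale unital_boolean_algebra = distributive_lattice L + bounded_lattice L for L (structure) +
  assumes complement_exists:
    "x \<in> carrier L \<Longrightarrow> \<exists>y\<in>carrier L. x \<sqinter> y = \<bottom> \<and> x \<squnion> y = \<top>"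

definition principal_ideal :: "'a gorder \<Rightarrow> 'a \<Rightarrow> 'a gorder" where
  "principal_ideal L x = L\<lparr>carrier := {y \<in> carrier L. y \<sqsubseteq>\<^bsub>L\<^esub> x}\<rparr>"

locale generalized_boolean_algebra =
  distributive_lattice L + weak_partial_order_bottom L for L :: "'a gorder" (structure) +
  assumes principal_ideal_boolean:
    "x \<in> carrier L \<Longrightarrow> unital_boolean_algebra (principal_ideal L x)"

locale distributive_inverse_semigroup = inverse_semigroup S for S (structure) +
  assumes zero_exists: "has_zero S"
    and compatible_join_exists:
      "\<lbrakk>a \<in> carrier S; b \<in> carrier S; compatible S a b\<rbrakk> \<Longrightarrow> \<exists>j. is_join S j a b"
    and mult_join_distrib_left:
      "\<lbrakk>a \<in> carrier S; b \<in> carrier S; c \<in> carrier S; compatible S a b; is_join S j a b\<rbrakk>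
        \<Longrightarrow> is_join S (c \<otimes> j) (c \<otimes> a) (c \<otimes> b)"
    and mult_join_distrib_right:
      "\<lbrakk>a \<in> carrier S; b \<in> carrier S; c \<in> carrier S; compatible S a b; is_join S j a b\<rbrakk>
        \<Longrightarrow> is_join S (j \<otimes> c) (a \<otimes> c) (b \<otimes> c)"

locale boolean_inverse_semigroup = distributive_inverse_semigroup S for S (structure) +
  assumes idempotents_boolean:
    "generalized_boolean_algebra ((natural_order S)\<lparr>carrier := idempotents S\<rparr>)"

definition boolean_morphism ::
    "('a, 'm) monoid_scheme \<Rightarrow> ('b, 'n) monoid_scheme \<Rightarrow> ('a \<Rightarrow> 'b) set" where
  "boolean_morphism S T = {h \<in> zero_hom S T.
    \<forall>a\<in>carrier S. \<forall>b\<in>carrier S. \<forall>j. compatible S a b \<and> is_join S j a b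
      \<longrightarrow> is_join T (h j) (h a) (h b)}"


section \<open>Booleanization\<close>

text \<open>
  The universal property quantifies over all Boolean inverse semigroups \<open>T\<close>. As HOL cannot
  quantify over types inside a formula, the element type \<open>'t\<close> of the test objects \<open>T\<close> is an
  explicit parameter. Uniqueness of the induced morphism is uniqueness on the carrier,
  hence the restriction to \<^const>\<open>extensional\<close> functions.
\<close>

definition is_booleanization_with_zero ::
    "'t itself \<Rightarrow> ('a, 'm) monoid_scheme \<Rightarrow> ('b, 'n) monoid_scheme \<Rightarrow> ('a \<Rightarrow> 'b) \<Rightarrow> bool" where
  "is_booleanization_with_zero (_ :: 't itself) S B \<beta> \<longleftrightarrow>
    boolean_inverse_semigroup B \<and> \<beta> \<in> zero_hom S B \<and>
    (\<forall>(T :: 't monoid) \<alpha>. boolean_inverse_semigroup T \<and> \<alpha> \<in> zero_hom S T \<longrightarrow>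
      (\<exists>!\<gamma>. \<gamma> \<in> extensional (carrier B) \<and> \<gamma> \<in> boolean_morphism B T \<and>
        (\<forall>s\<in>carrier S. \<gamma> (\<beta> s) = \<alpha> s)))"

text \<open>
  The universal map has domain \<open>S\<close> or \<open>S\<close> with a zero adjoined. To give both cases one type,
  it is a function on \<open>'a option\<close>; if \<open>S\<close> has a zero, only its values \<open>\<beta> (Some s)\<close> matter.
\<close>

definition is_booleanization ::
    "'t itself \<Rightarrow> ('a, 'm) monoid_scheme \<Rightarrow> ('b, 'n) monoid_scheme \<Rightarrow> ('a option \<Rightarrow> 'b) \<Rightarrow> bool" where
  "is_booleanization (TT :: 't itself) S B \<beta> \<longleftrightarrow>
    (if has_zero S then is_booleanization_with_zero TT S B (\<lambda>s. \<beta> (Some s))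
     else is_booleanization_with_zero TT (adjoin_zero S) B \<beta>)"


section \<open>Groupoids and local bisections\<close>

text \<open>
  Groupoids are given by their arrows, with identities identified with objects; the partial
  composition is \<^const>\<open>None\<close> where it is undefined.
\<close>

record 'a groupoid = "'a partial_object" +
  gcomp :: "'a \<Rightarrow> 'a \<Rightarrow> 'a option"
  ginv :: "'a \<Rightarrow> 'a"

definition gdom :: "('a, 'm) groupoid_scheme \<Rightarrow> 'a \<Rightarrow> 'a" where
  "gdom G x = the (gcomp G (ginv G x) x)"

definition gran :: "('a, 'm) groupoid_scheme \<Rightarrow> 'a \<Rightarrow> 'a" where
  "gran G x = the (gcomp G x (ginv G x))"

definition local_bisection :: "('a, 'm) groupoid_scheme \<Rightarrow> 'a set \<Rightarrow> bool" where
  "local_bisection G A \<longleftrightarrow> A \<subseteq> carrier G \<and>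
    (\<forall>a\<in>A. \<forall>b\<in>A. (gdom G a = gdom G b \<longrightarrow> a = b) \<and> (gran G a = gran G b \<longrightarrow> a = b))"

definition K :: "('a, 'm) groupoid_scheme \<Rightarrow> 'a set monoid" where
  "K G =
    \<lparr>carrier = {A. local_bisection G A},
     mult = (\<lambda>A B. {the (gcomp G a b) | a b. a \<in> A \<and> b \<in> B \<and> gdom G a = gran G b}),
     one = gdom G ` carrier G\<rparr>"

text \<open>If \<open>S\<close> has no zero, then nothing is removed from its carrier.\<close>

definition restricted_groupoid :: "('a, 'm) monoid_scheme \<Rightarrow> 'a groupoid" where
  "restricted_groupoid S =
    \<lparr>carrier = {s \<in> carrier S. \<not> is_zero S s},
     gcomp = (\<lambda>a b. if sdom S a = sran S b then Some (a \<otimes>\<^bsub>S\<^esub> b) else None),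
     ginv = sinv S\<rparr>"

end

theory Submission
  imports Defs
begin

text \<open>
  Let \<open>\<beta> s\<close> be the set of nonzero elements below \<open>s\<close> in the natural partial order
  (\<open>principal_bisection\<close>). An element below \<open>s\<close> is determined by its domain, and by its range,
  so \<open>\<beta> s\<close> is a local bisection of the restricted groupoid; and \<open>\<beta>\<close> is multiplicative because
  an element below a product factorizes as a restricted product of elements below the factors
  (\<open>nle_mult_factor\<close>). The local bisections of any groupoid form a Boolean inverse monoid: the
  natural partial order is inclusion, compatible joins are unions, and the idempotents are all
  sets of identities (\<open>boolean_inverse_semigroup_K\<close>).

  For the universal property, let \<open>\<alpha>\<close> be a homomorphism from \<open>S\<close> to a Boolean inverse semigroup
  \<open>T\<close>. As \<open>S\<close> is finite, the idempotent \<open>\<alpha> e\<close> has a relative complement of the join of all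
  \<open>\<alpha> f\<close> with \<open>f\<close> strictly below \<open>e\<close>, the layer of \<open>e\<close>. If \<open>e\<close> is nonzero,
  \<open>\<beta> e\<close> is the union of \<open>{e}\<close> and these \<open>\<beta> f\<close>, so the layer is the only possible image of
  \<open>{e}\<close>; and as \<open>{a}\<close> is the product of \<open>\<beta> a\<close> and the singleton of the domain of \<open>a\<close>, the
  only possible image of \<open>{a}\<close> is \<open>\<alpha> a\<close> times the layer of its domain (\<open>part\<close>). A local
  bisection is a finite union of singletons, so this proves uniqueness (\<open>morphism_eq_extension\<close>).

  For existence, distinct idempotents have orthogonal layers (\<open>layers_disjoint\<close>), and
  conjugation by \<open>\<alpha> b\<close> exchanges the layers of the domain and the range of \<open>b\<close>
  (\<open>layer_conj\<close>). Hence \<open>part\<close> turns restricted products into products, and sends the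
  pairs that cannot be composed to zero (\<open>part_mult\<close>). The parts of the elements of a local
  bisection are therefore compatible; sending the bisection to their join is multiplicative
  by distributivity (\<open>extension_mult\<close>), and extends \<open>\<alpha>\<close> because \<open>\<alpha> s\<close> is the join of the
  parts of the elements below \<open>s\<close> (\<open>lub_parts\<close>).
\<close>

section \<open>Inverse semigroups and their natural partial order\<close>

definition nle :: "('a, 'm) monoid_scheme \<Rightarrow> 'a \<Rightarrow> 'a \<Rightarrow> bool" (infix \<open>\<preceq>\<index>\<close> 50) where
  "a \<preceq>\<^bsub>S\<^esub> b \<longleftrightarrow> a = b \<otimes>\<^bsub>S\<^esub> sinv S a \<otimes>\<^bsub>S\<^esub> a"

definition lub :: "('a, 'm) monoid_scheme \<Rightarrow> 'a set \<Rightarrow> 'a \<Rightarrow> bool" where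
  "lub S X j \<longleftrightarrow> j \<in> carrier S \<and> (\<forall>x\<in>X. x \<preceq>\<^bsub>S\<^esub> j)
    \<and> (\<forall>u\<in>carrier S. (\<forall>x\<in>X. x \<preceq>\<^bsub>S\<^esub> u) \<longrightarrow> j \<preceq>\<^bsub>S\<^esub> u)"

lemma is_join_iff_lub:
  assumes "a \<in> carrier S" "b \<in> carrier S"
  shows "is_join S j a b \<longleftrightarrow> lub S {a, b} j"
  using assms by (auto simp: least_def Upper_def natural_order_def lub_def nle_def)

lemma is_zero_unique: "is_zero S z \<Longrightarrow> is_zero S z' \<Longrightarrow> z = z'"
  unfolding is_zero_def by metis

context inverse_semigroup
begin

lemma
  assumes "a \<in> carrier S"
  shows sinv_closed [simp]: "sinv S a \<in> carrier S"
    and mult_sinv_mult: "a \<otimes> sinv S a \<otimes> a = a"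
    and sinv_mult_sinv: "sinv S a \<otimes> a \<otimes> sinv S a = sinv S a"
  using theI'[OF unique_inverse[OF assms]] unfolding sinv_def by auto

lemma sinv_eqI:
  assumes "a \<in> carrier S" "b \<in> carrier S" "a \<otimes> b \<otimes> a = a" "b \<otimes> a \<otimes> b = b"
  shows "sinv S a = b"
  unfolding sinv_def using assms by (intro the1_equality unique_inverse) auto

declare m_closed [simp] m_assoc [simp]

lemma mult_sinv_cancel [simp]:
  assumes "a \<in> carrier S"
  shows "a \<otimes> (sinv S a \<otimes> a) = a" "sinv S a \<otimes> (a \<otimes> sinv S a) = sinv S a"
    and "x \<in> carrier S \<Longrightarrow> a \<otimes> (sinv S a \<otimes> (a \<otimes> x)) = a \<otimes> x"
    and "x \<in> carrier S \<Longrightarrow> sinv S a \<otimes> (a \<otimes> (sinv S a \<otimes> x)) = sinv S a \<otimes> x"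
proof -
  note a = mult_sinv_mult[OF assms] sinv_mult_sinv[OF assms]
  show *: "a \<otimes> (sinv S a \<otimes> a) = a" "sinv S a \<otimes> (a \<otimes> sinv S a) = sinv S a"
    using a assms by simp_all
  show "a \<otimes> (sinv S a \<otimes> (a \<otimes> x)) = a \<otimes> x" if "x \<in> carrier S"
    using arg_cong[OF a(1), of "\<lambda>y. y \<otimes> x"] that assms by simp
  show "sinv S a \<otimes> (a \<otimes> (sinv S a \<otimes> x)) = sinv S a \<otimes> x" if "x \<in> carrier S"
    using arg_cong[OF a(2), of "\<lambda>y. y \<otimes> x"] that assms by simp
qed

lemma sinv_sinv [simp]: "a \<in> carrier S \<Longrightarrow> sinv S (sinv S a) = a"
  by (rule sinv_eqI) auto

lemma idem_closed [simp]: "e \<in> idempotents S \<Longrightarrow> e \<in> carrier S"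
  and idem_square [simp]: "e \<in> idempotents S \<Longrightarrow> e \<otimes> e = e"
  and idemI: "e \<in> carrier S \<Longrightarrow> e \<otimes> e = e \<Longrightarrow> e \<in> idempotents S"
  unfolding idempotents_def by blast+

lemma idem_absorb [simp]: "e \<in> idempotents S \<Longrightarrow> x \<in> carrier S \<Longrightarrow> e \<otimes> (e \<otimes> x) = e \<otimes> x"
  using arg_cong[OF idem_square, of e "\<lambda>y. y \<otimes> x"] by (simp del: idem_square)

lemma sinv_idem [simp]: "e \<in> idempotents S \<Longrightarrow> sinv S e = e"
  by (rule sinv_eqI) auto

text \<open>The inverse \<open>x\<close> of \<open>e \<otimes> f\<close> is idempotent, because \<open>f \<otimes> x \<otimes> e\<close> is also an inverse of
  \<open>e \<otimes> f\<close>. So \<open>e \<otimes> f\<close>, the inverse of \<open>x\<close>, is idempotent.\<close>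

lemma idem_mult [simp]:
  assumes "e \<in> idempotents S" "f \<in> idempotents S"
  shows "e \<otimes> f \<in> idempotents S"
proof -
  let ?x = "sinv S (e \<otimes> f)"
  have c: "e \<in> carrier S" "f \<in> carrier S" using assms by auto
  have x: "?x = f \<otimes> ?x \<otimes> e"
  proof (rule sinv_eqI)
    show "e \<otimes> f \<otimes> (f \<otimes> ?x \<otimes> e) \<otimes> (e \<otimes> f) = e \<otimes> f"
      using assms c mult_sinv_mult[of "e \<otimes> f"] by (simp del: mult_sinv_cancel)
    show "f \<otimes> ?x \<otimes> e \<otimes> (e \<otimes> f) \<otimes> (f \<otimes> ?x \<otimes> e) = f \<otimes> ?x \<otimes> e"
      using assms c mult_sinv_cancel(4)[of "e \<otimes> f" e] by (simp del: mult_sinv_cancel)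
  qed (use c in auto)
  have "(f \<otimes> ?x \<otimes> e) \<otimes> (f \<otimes> ?x \<otimes> e) = f \<otimes> ?x \<otimes> e"
    using assms c mult_sinv_cancel(4)[of "e \<otimes> f" e] by (simp del: mult_sinv_cancel)
  then have "?x \<otimes> ?x = ?x" unfolding x[symmetric] .
  then have "?x \<in> idempotents S" using c by (intro idemI) auto
  then have "sinv S ?x \<in> idempotents S" by simp
  then show ?thesis using c by simp
qed

text \<open>The idempotent \<open>e \<otimes> f\<close> is its own inverse, but \<open>f \<otimes> e\<close> is an inverse of it too.\<close>

lemma idem_commute:
  assumes "e \<in> idempotents S" "f \<in> idempotents S"
  shows "e \<otimes> f = f \<otimes> e"
proof -
  have *: "x \<otimes> (y \<otimes> (x \<otimes> y)) = x \<otimes> y"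
    if "x \<in> idempotents S" "y \<in> idempotents S" for x y
    using idem_square[OF idem_mult[OF that]] that by (simp del: idem_square)
  have "sinv S (e \<otimes> f) = f \<otimes> e"
    using assms by (intro sinv_eqI) (auto simp: *)
  then show ?thesis using assms by simp
qed

lemma sinv_mult_idem [simp]: "a \<in> carrier S \<Longrightarrow> sinv S a \<otimes> a \<in> idempotents S"
  and mult_sinv_idem [simp]: "a \<in> carrier S \<Longrightarrow> a \<otimes> sinv S a \<in> idempotents S"
  by (auto intro: idemI)

lemma sinv_mult:
  assumes "a \<in> carrier S" "b \<in> carrier S"
  shows "sinv S (a \<otimes> b) = sinv S b \<otimes> sinv S a"
proof (rule sinv_eqI)
  have *: "b \<otimes> sinv S b \<otimes> (sinv S a \<otimes> a) = sinv S a \<otimes> a \<otimes> (b \<otimes> sinv S b)"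
    using assms by (intro idem_commute) auto
  have "a \<otimes> b \<otimes> (sinv S b \<otimes> sinv S a) \<otimes> (a \<otimes> b) = a \<otimes> (b \<otimes> sinv S b \<otimes> (sinv S a \<otimes> a)) \<otimes> b"
    using assms by simp
  then show "a \<otimes> b \<otimes> (sinv S b \<otimes> sinv S a) \<otimes> (a \<otimes> b) = a \<otimes> b"
    unfolding * using assms by simp
  have "sinv S b \<otimes> sinv S a \<otimes> (a \<otimes> b) \<otimes> (sinv S b \<otimes> sinv S a)
      = sinv S b \<otimes> (sinv S a \<otimes> a \<otimes> (b \<otimes> sinv S b)) \<otimes> sinv S a"
    using assms by simp
  then show "sinv S b \<otimes> sinv S a \<otimes> (a \<otimes> b) \<otimes> (sinv S b \<otimes> sinv S a) = sinv S b \<otimes> sinv S a"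
    unfolding *[symmetric] using assms by simp
qed (use assms in auto)

lemma conj_idem:
  assumes "a \<in> carrier S" "e \<in> idempotents S"
  shows "a \<otimes> e \<otimes> sinv S a \<in> idempotents S"
proof -
  have *: "e \<otimes> (sinv S a \<otimes> a) = sinv S a \<otimes> a \<otimes> e"
    using assms by (intro idem_commute) auto
  have "a \<otimes> e \<otimes> sinv S a \<otimes> (a \<otimes> e \<otimes> sinv S a) = a \<otimes> (e \<otimes> (sinv S a \<otimes> a)) \<otimes> e \<otimes> sinv S a"
    using assms by simp
  also have "\<dots> = a \<otimes> e \<otimes> sinv S a"
    unfolding * using assms by simp
  finally show ?thesis using assms by (intro idemI) auto
qed

lemma conj_idem': "a \<in> carrier S \<Longrightarrow> e \<in> idempotents S \<Longrightarrow> sinv S a \<otimes> e \<otimes> a \<in> idempotents S"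
  using conj_idem[of "sinv S a" e] by simp

text \<open>An idempotent moves through an element at the price of a conjugation.\<close>

lemma mult_idem_eq_conj:
  assumes "a \<in> carrier S" "e \<in> idempotents S"
  shows "a \<otimes> e = a \<otimes> e \<otimes> sinv S a \<otimes> a"
proof -
  have "a \<otimes> e \<otimes> sinv S a \<otimes> a = a \<otimes> (e \<otimes> (sinv S a \<otimes> a))" using assms by simp
  also have "\<dots> = a \<otimes> e"
    using assms by (subst idem_commute) auto
  finally show ?thesis by simp
qed

lemma idem_mult_eq_conj:
  assumes "a \<in> carrier S" "e \<in> idempotents S"
  shows "e \<otimes> a = a \<otimes> (sinv S a \<otimes> e \<otimes> a)"
proof -
  have "a \<otimes> (sinv S a \<otimes> e \<otimes> a) = (a \<otimes> sinv S a \<otimes> e) \<otimes> a" using assms by simp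
  also have "\<dots> = e \<otimes> a"
    using assms by (subst idem_commute) auto
  finally show ?thesis by simp
qed

lemma sdom_idem [simp]: "a \<in> carrier S \<Longrightarrow> sdom S a \<in> idempotents S"
  and sran_idem [simp]: "a \<in> carrier S \<Longrightarrow> sran S a \<in> idempotents S"
  and mult_sdom [simp]: "a \<in> carrier S \<Longrightarrow> a \<otimes> sdom S a = a"
  and sran_mult [simp]: "a \<in> carrier S \<Longrightarrow> sran S a \<otimes> a = a"
  and sdom_sinv [simp]: "a \<in> carrier S \<Longrightarrow> sdom S (sinv S a) = sran S a"
  and sran_sinv [simp]: "a \<in> carrier S \<Longrightarrow> sran S (sinv S a) = sdom S a"
  and sdom_of_idem [simp]: "e \<in> idempotents S \<Longrightarrow> sdom S e = e"
  and sran_of_idem [simp]: "e \<in> idempotents S \<Longrightarrow> sran S e = e"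
  by (auto simp: sdom_def sran_def)

lemma sdom_mult_of_composable:
  assumes "a \<in> carrier S" "b \<in> carrier S" "sdom S a = sran S b"
  shows "sdom S (a \<otimes> b) = sdom S b" "sran S (a \<otimes> b) = sran S a"
proof -
  have "sdom S (a \<otimes> b) = sinv S b \<otimes> (sdom S a \<otimes> b)"
    using assms(1,2) by (simp add: sdom_def sinv_mult)
  then show "sdom S (a \<otimes> b) = sdom S b"
    unfolding assms(3) using assms(2) by (simp add: sdom_def[of S b])
  have "sran S (a \<otimes> b) = a \<otimes> (sran S b) \<otimes> sinv S a"
    using assms(1,2) by (simp add: sran_def sinv_mult)
  then show "sran S (a \<otimes> b) = sran S a"
    unfolding assms(3)[symmetric] using assms(1) by (simp add: sran_def)
qed

lemma nle_iff_sdom: "a \<in> carrier S \<Longrightarrow> b \<in> carrier S \<Longrightarrow> a \<preceq> b \<longleftrightarrow> a = b \<otimes> sdom S a"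
  unfolding nle_def sdom_def by (simp only: m_assoc sinv_closed)

lemma nle_iff_mult_idem:
  assumes "a \<in> carrier S" "b \<in> carrier S"
  shows "a \<preceq> b \<longleftrightarrow> (\<exists>e\<in>idempotents S. a = b \<otimes> e)"
proof
  assume "a \<preceq> b"
  then have "a = b \<otimes> sdom S a" using assms by (simp only: nle_iff_sdom)
  then show "\<exists>e\<in>idempotents S. a = b \<otimes> e"
    using sdom_idem[OF assms(1)] by (rule bexI)
next
  assume "\<exists>e\<in>idempotents S. a = b \<otimes> e"
  then obtain e where e: "e \<in> idempotents S" "a = b \<otimes> e" by blast
  have "b \<otimes> sinv S a \<otimes> a = b \<otimes> (e \<otimes> (sinv S b \<otimes> b)) \<otimes> e"
    using e assms by (simp add: sinv_mult)
  also have "\<dots> = a"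
    using e assms by (subst idem_commute[of e "sinv S b \<otimes> b"]) auto
  finally show "a \<preceq> b" unfolding nle_def by (rule sym)
qed

lemma nle_iff_idem_mult:
  assumes "a \<in> carrier S" "b \<in> carrier S"
  shows "a \<preceq> b \<longleftrightarrow> (\<exists>e\<in>idempotents S. a = e \<otimes> b)"
  unfolding nle_iff_mult_idem[OF assms]
proof
  assume "\<exists>e\<in>idempotents S. a = b \<otimes> e"
  then obtain e where e: "e \<in> idempotents S" "a = b \<otimes> e" by blast
  then show "\<exists>e\<in>idempotents S. a = e \<otimes> b"
    using assms(2) mult_idem_eq_conj[of b e] conj_idem[of b e] by blast
next
  assume "\<exists>e\<in>idempotents S. a = e \<otimes> b"
  then obtain e where e: "e \<in> idempotents S" "a = e \<otimes> b" by blast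
  then show "\<exists>e\<in>idempotents S. a = b \<otimes> e"
    using assms(2) idem_mult_eq_conj[of b e] conj_idem'[of b e] by blast
qed

lemma nle_refl [simp]: "a \<in> carrier S \<Longrightarrow> a \<preceq> a"
  by (simp add: nle_def)

lemma nle_antisym:
  assumes "a \<preceq> b" "b \<preceq> a" and c: "a \<in> carrier S" "b \<in> carrier S"
  shows "a = b"
proof -
  have h: "a = b \<otimes> sdom S a" "b = a \<otimes> sdom S b"
    using assms by (simp_all only: nle_iff_sdom)
  have "a = a \<otimes> sdom S b \<otimes> sdom S a"
    using arg_cong[OF h(2), of "\<lambda>x. x \<otimes> sdom S a"] h(1) by (rule trans[rotated])
  also have "\<dots> = a \<otimes> (sdom S b \<otimes> sdom S a)" using c by simp
  also have "\<dots> = a \<otimes> (sdom S a \<otimes> sdom S b)" using c by (subst idem_commute) auto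
  also have "\<dots> = a \<otimes> sdom S a \<otimes> sdom S b" using c by (intro m_assoc[symmetric]) auto
  also have "\<dots> = a \<otimes> sdom S b" using c by simp
  finally show ?thesis by (rule trans[OF _ h(2)[symmetric]])
qed

lemma nle_trans:
  assumes "a \<preceq> b" "b \<preceq> d" "a \<in> carrier S" "b \<in> carrier S" "d \<in> carrier S"
  shows "a \<preceq> d"
  using assms by (auto simp: nle_iff_mult_idem intro!: bexI[OF _ idem_mult])

lemma mult_idem_nle: "a \<in> carrier S \<Longrightarrow> e \<in> idempotents S \<Longrightarrow> a \<otimes> e \<preceq> a"
  and idem_mult_nle: "a \<in> carrier S \<Longrightarrow> e \<in> idempotents S \<Longrightarrow> e \<otimes> a \<preceq> a"
proof -
  assume a: "a \<in> carrier S" and e: "e \<in> idempotents S"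
  show "a \<otimes> e \<preceq> a" using a e by (subst nle_iff_mult_idem) auto
  show "e \<otimes> a \<preceq> a" using a e by (subst nle_iff_idem_mult) auto
qed

lemma nle_mult:
  assumes "a \<preceq> b" "c \<preceq> d" "a \<in> carrier S" "b \<in> carrier S" "c \<in> carrier S" "d \<in> carrier S"
  shows "a \<otimes> c \<preceq> b \<otimes> d"
proof -
  obtain e where e: "e \<in> idempotents S" "a = e \<otimes> b" using assms nle_iff_idem_mult by auto
  obtain f where f: "f \<in> idempotents S" "c = d \<otimes> f" using assms nle_iff_mult_idem by auto
  have "a \<otimes> c = e \<otimes> (b \<otimes> d) \<otimes> f" using e f assms by simp
  moreover have "e \<otimes> (b \<otimes> d) \<otimes> f \<preceq> e \<otimes> (b \<otimes> d)"
    using e(1) f(1) assms(4,6) by (intro mult_idem_nle) auto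
  moreover have "e \<otimes> (b \<otimes> d) \<preceq> b \<otimes> d" using e(1) assms(4,6) by (intro idem_mult_nle) auto
  ultimately show ?thesis using e(1) f(1) assms(4,6)
    by (auto intro: nle_trans[of _ "e \<otimes> (b \<otimes> d)"])
qed

lemma nle_sinv:
  assumes "a \<preceq> b" "a \<in> carrier S" "b \<in> carrier S"
  shows "sinv S a \<preceq> sinv S b"
proof -
  obtain e where e: "e \<in> idempotents S" "a = e \<otimes> b" using assms nle_iff_idem_mult by auto
  then show ?thesis using assms by (auto simp: sinv_mult nle_iff_mult_idem)
qed

lemma nle_sdom: "a \<preceq> b \<Longrightarrow> a \<in> carrier S \<Longrightarrow> b \<in> carrier S \<Longrightarrow> sdom S a \<preceq> sdom S b"
  unfolding sdom_def by (intro nle_mult nle_sinv) auto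

lemma nle_idem:
  assumes "a \<preceq> e" "a \<in> carrier S" "e \<in> idempotents S"
  shows "a \<in> idempotents S"
  using assms by (auto simp: nle_iff_mult_idem)

lemma idem_nle_iff:
  assumes "e \<in> idempotents S" "f \<in> idempotents S"
  shows "e \<preceq> f \<longleftrightarrow> e \<otimes> f = e"
  using assms by (auto simp: nle_def idem_commute)

lemma compatible_idem: "e \<in> idempotents S \<Longrightarrow> f \<in> idempotents S \<Longrightarrow> compatible S e f"
  by (simp add: compatible_def)

lemma zero_closed [simp]: "is_zero S z \<Longrightarrow> z \<in> carrier S"
  and zero_mult [simp]: "is_zero S z \<Longrightarrow> a \<in> carrier S \<Longrightarrow> z \<otimes> a = z"
  and mult_zero [simp]: "is_zero S z \<Longrightarrow> a \<in> carrier S \<Longrightarrow> a \<otimes> z = z"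
  unfolding is_zero_def by blast+

lemma zero_idem [simp]: "is_zero S z \<Longrightarrow> z \<in> idempotents S"
  by (intro idemI) auto

lemma zero_nle [simp]: "is_zero S z \<Longrightarrow> a \<in> carrier S \<Longrightarrow> z \<preceq> a"
  by (simp add: nle_def)

lemma nle_zero: "a \<preceq> z \<Longrightarrow> is_zero S z \<Longrightarrow> a \<in> carrier S \<Longrightarrow> a = z"
  by (rule nle_antisym) auto

lemma lub_unique: "lub S X i \<Longrightarrow> lub S X j \<Longrightarrow> i = j"
  by (meson nle_antisym lub_def)

text \<open>A least upper bound \<open>j\<close> of idempotents lies below its own domain idempotent,
  because each of the idempotents does.\<close>

lemma lub_idem:
  assumes "lub S X j" "X \<subseteq> idempotents S"
  shows "j \<in> idempotents S"
proof -
  have j: "j \<in> carrier S" using assms by (simp add: lub_def)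
  have "x \<preceq> sdom S j" if "x \<in> X" for x
  proof -
    have x: "x \<in> idempotents S" "x \<preceq> j" using that assms by (auto simp: lub_def)
    then show ?thesis using nle_sdom[of x j] j by simp
  qed
  then have "j \<preceq> sdom S j" using assms(1) j by (simp add: lub_def)
  then show ?thesis using j by (intro nle_idem[of j "sdom S j"]) auto
qed

end

section \<open>Powersets as generalized Boolean algebras\<close>

text \<open>The order is described by its restriction to \<open>Pow U\<close>, because the natural partial order of
  an inverse semigroup is an arbitrary relation off the carrier.\<close>

lemma powerset_unital_boolean_algebra:
  fixes L :: "'a set gorder" (structure)
  assumes L: "carrier L = Pow U" "eq L = (=)" "\<And>A B. A \<subseteq> U \<Longrightarrow> B \<subseteq> U \<Longrightarrow> le L A B \<longleftrightarrow> A \<subseteq> B"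
  shows "unital_boolean_algebra L"
proof -
  have lub_un: "is_lub L (A \<union> B) {A, B}" and glb_int: "is_glb L (A \<inter> B) {A, B}"
    if "A \<in> carrier L" "B \<in> carrier L" for A B
  proof -
    have AB: "A \<subseteq> U" "B \<subseteq> U" using that by (simp_all add: L(1))
    show "is_lub L (A \<union> B) {A, B}"
    proof (rule least_UpperI)
      fix C assume "C \<in> Upper L {A, B}"
      then have "C \<subseteq> U" "A \<sqsubseteq> C" "B \<sqsubseteq> C"
        using that by (auto simp: Upper_def L(1))
      then show "A \<union> B \<sqsubseteq> C" using AB by (simp add: L(3))
    qed (use AB in \<open>auto simp: L(1,3)\<close>)
    show "is_glb L (A \<inter> B) {A, B}"
    proof (rule greatest_LowerI)
      fix C assume "C \<in> Lower L {A, B}"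
      then have "C \<subseteq> U" "C \<sqsubseteq> A" "C \<sqsubseteq> B"
        using that by (auto simp: Lower_def L(1))
      then show "C \<sqsubseteq> A \<inter> B" using AB by (simp add: L(3) le_infI1)
    qed (use AB in \<open>auto simp: L(1,3) le_infI1\<close>)
  qed
  have least_empty: "least L {} (carrier L)" and greatest_all: "greatest L U (carrier L)"
    by (auto simp: L least_def greatest_def)
  interpret bounded_lattice L
  proof unfold_locales
    show "\<exists>s. is_lub L s {x, y}" "\<exists>s. is_glb L s {x, y}"
      if "x \<in> carrier L" "y \<in> carrier L" for x y
      using lub_un[OF that] glb_int[OF that] by blast+
    show "\<exists>x. least L x (carrier L)" "\<exists>x. greatest L x (carrier L)"
      using least_empty greatest_all by blast+
  qed (auto simp: L)
  have join: "A \<squnion> B = A \<union> B" and meet: "A \<sqinter> B = A \<inter> B"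
    if "A \<in> carrier L" "B \<in> carrier L" for A B
  proof -
    show "A \<squnion> B = A \<union> B"
      using joinI[of A B "\<lambda>l. l = A \<union> B"] least_unique[OF _ lub_un[OF that]] that by blast
    show "A \<sqinter> B = A \<inter> B"
      using meetI[of A B "\<lambda>l. l = A \<inter> B"] greatest_unique[OF _ glb_int[OF that]] that by blast
  qed
  have bottom: "\<bottom> = {}" and top: "\<top> = U"
    using least_empty greatest_all bottom_least top_greatest least_unique greatest_unique by blast+
  show ?thesis
  proof unfold_locales
    show "x \<sqinter> (y \<squnion> z) = x \<sqinter> y \<squnion> x \<sqinter> z"
      if "x \<in> carrier L" "y \<in> carrier L" "z \<in> carrier L" for x y z
      using that by (simp add: join meet) (simp add: join meet L Int_Un_distrib le_infI1)
    show "\<exists>y\<in>carrier L. x \<sqinter> y = \<bottom> \<and> x \<squnion> y = \<top>" if "x \<in> carrier L" for x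
    proof (rule bexI[of _ "U - x"])
      show "U - x \<in> carrier L" by (auto simp: L)
      then show "x \<sqinter> (U - x) = \<bottom> \<and> x \<squnion> (U - x) = \<top>"
        using that join[OF that] meet[OF that]
        by (auto simp: bottom top L)
    qed
  qed
qed

lemma powerset_generalized_boolean_algebra:
  fixes L :: "'a set gorder" (structure)
  assumes L: "carrier L = Pow U" "eq L = (=)" "\<And>A B. A \<subseteq> U \<Longrightarrow> B \<subseteq> U \<Longrightarrow> le L A B \<longleftrightarrow> A \<subseteq> B"
  shows "generalized_boolean_algebra L"
proof -
  interpret unital_boolean_algebra L
    using assms by (rule powerset_unital_boolean_algebra)
  show ?thesis
  proof (intro generalized_boolean_algebra.intro generalized_boolean_algebra_axioms.intro)
    show "distributive_lattice L" "weak_partial_order_bottom L" by unfold_locales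
    fix A assume A: "A \<in> carrier L"
    show "unital_boolean_algebra (principal_ideal L A)"
      using A by (intro powerset_unital_boolean_algebra[of _ A]) (auto simp: principal_ideal_def L)
  qed
qed

section \<open>The Boolean inverse monoid of local bisections of a groupoid\<close>

text \<open>Composition enters through the value of \<open>gcomp\<close> on the pairs with matching ends. That
  \<open>ginv\<close> inverts is built into \<open>gdom\<close> and \<open>gran\<close>, by definition the composites of an arrow
  with its inverse.\<close>

locale groupoid_laws =
  fixes G :: "('a, 'm) groupoid_scheme" (structure)
  assumes ginv_closed: "x \<in> carrier G \<Longrightarrow> ginv G x \<in> carrier G"
    and gdom_closed: "x \<in> carrier G \<Longrightarrow> gdom G x \<in> carrier G"
    and gdom_ginv: "x \<in> carrier G \<Longrightarrow> gdom G (ginv G x) = gran G x"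
    and gran_ginv: "x \<in> carrier G \<Longrightarrow> gran G (ginv G x) = gdom G x"
    and gdom_gdom: "x \<in> carrier G \<Longrightarrow> gdom G (gdom G x) = gdom G x"
    and gran_gdom: "x \<in> carrier G \<Longrightarrow> gran G (gdom G x) = gdom G x"
    and gcomp_closed: "\<lbrakk>x \<in> carrier G; y \<in> carrier G; gdom G x = gran G y\<rbrakk>
      \<Longrightarrow> the (gcomp G x y) \<in> carrier G"
    and gdom_gcomp: "\<lbrakk>x \<in> carrier G; y \<in> carrier G; gdom G x = gran G y\<rbrakk>
      \<Longrightarrow> gdom G (the (gcomp G x y)) = gdom G y"
    and gran_gcomp: "\<lbrakk>x \<in> carrier G; y \<in> carrier G; gdom G x = gran G y\<rbrakk>
      \<Longrightarrow> gran G (the (gcomp G x y)) = gran G x"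
    and gcomp_assoc: "\<lbrakk>x \<in> carrier G; y \<in> carrier G; z \<in> carrier G;
        gdom G x = gran G y; gdom G y = gran G z\<rbrakk>
      \<Longrightarrow> the (gcomp G (the (gcomp G x y)) z) = the (gcomp G x (the (gcomp G y z)))"
    and gcomp_gdom: "x \<in> carrier G \<Longrightarrow> the (gcomp G x (gdom G x)) = x"
    and gran_gcomp_self: "x \<in> carrier G \<Longrightarrow> the (gcomp G (gran G x) x) = x"
begin

abbreviation comp :: "'a \<Rightarrow> 'a \<Rightarrow> 'a" (infixl \<open>\<cdot>\<close> 70) where
  "x \<cdot> y \<equiv> the (gcomp G x y)"

abbreviation bisections :: "'a set set" where
  "bisections \<equiv> {A. local_bisection G A}"

abbreviation units :: "'a set" where
  "units \<equiv> gdom G ` carrier G"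

lemmas G_simps [simp] = ginv_closed gdom_closed gdom_ginv gran_ginv gdom_gdom gran_gdom
  gcomp_closed gdom_gcomp gran_gcomp gcomp_gdom gran_gcomp_self

lemma gran_closed [simp]: "x \<in> carrier G \<Longrightarrow> gran G x \<in> carrier G"
  and gdom_gran [simp]: "x \<in> carrier G \<Longrightarrow> gdom G (gran G x) = gran G x"
  and gran_gran [simp]: "x \<in> carrier G \<Longrightarrow> gran G (gran G x) = gran G x"
  and gran_in_units [simp]: "x \<in> carrier G \<Longrightarrow> gran G x \<in> units"
  using gdom_closed[of "ginv G x"] gdom_gdom[of "ginv G x"] gran_gdom[of "ginv G x"]
    imageI[of "ginv G x" "carrier G" "gdom G"] by simp_all

lemma ginv_gcomp [simp]: "ginv G x \<cdot> x = gdom G x"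
  and gcomp_ginv [simp]: "x \<cdot> ginv G x = gran G x"
  by (simp_all add: gdom_def gran_def)

lemma ginv_ginv [simp]:
  assumes "x \<in> carrier G"
  shows "ginv G (ginv G x) = x"
proof -
  have "ginv G (ginv G x) = ginv G (ginv G x) \<cdot> gdom G x"
    using gcomp_gdom[of "ginv G (ginv G x)"] assms by simp
  also have "\<dots> = ginv G (ginv G x) \<cdot> (ginv G x \<cdot> x)" by simp
  also have "\<dots> = ginv G (ginv G x) \<cdot> ginv G x \<cdot> x"
    using assms by (subst gcomp_assoc) (simp_all del: ginv_gcomp gcomp_ginv)
  also have "\<dots> = x" using assms by simp
  finally show ?thesis .
qed

lemma unit_eq: "u \<in> units \<Longrightarrow> gdom G u = u" "u \<in> units \<Longrightarrow> gran G u = u" "u \<in> units \<Longrightarrow> u \<in> carrier G"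
  by auto

text \<open>An arrow \<open>b\<close> with \<open>a \<cdot> b \<cdot> a = a\<close> is the inverse of \<open>a\<close>: cancel both factors \<open>a\<close>.\<close>

lemma ginv_unique:
  assumes c: "a \<in> carrier G" "b \<in> carrier G" and ab: "gdom G a = gran G b" "gdom G b = gran G a"
    and eq: "a \<cdot> b \<cdot> a = a"
  shows "b = ginv G a"
proof -
  have "gran G a = a \<cdot> b \<cdot> a \<cdot> ginv G a" using eq by simp
  also have "\<dots> = a \<cdot> b \<cdot> gran G a"
    using c ab by (subst gcomp_assoc) auto
  also have "\<dots> = a \<cdot> b"
    using gcomp_gdom[of "a \<cdot> b"] c ab by simp
  finally have "ginv G a \<cdot> (a \<cdot> b) = ginv G a \<cdot> gdom G (ginv G a)" using c by simp
  also have "\<dots> = ginv G a" using c by (intro gcomp_gdom) simp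
  finally have *: "ginv G a \<cdot> (a \<cdot> b) = ginv G a" .
  have "ginv G a \<cdot> (a \<cdot> b) = ginv G a \<cdot> a \<cdot> b" using c ab by (intro gcomp_assoc[symmetric]) auto
  then show ?thesis using * c ab by simp
qed

lemma carrier_K [simp]: "carrier (K G) = bisections"
  by (simp add: K_def)

lemma one_K [simp]: "one (K G) = units"
  by (simp add: K_def)

lemma mult_K: "A \<otimes>\<^bsub>K G\<^esub> B = {a \<cdot> b | a b. a \<in> A \<and> b \<in> B \<and> gdom G a = gran G b}"
  by (simp add: K_def)

lemma mult_K_I: "a \<in> A \<Longrightarrow> b \<in> B \<Longrightarrow> gdom G a = gran G b \<Longrightarrow> a \<cdot> b \<in> A \<otimes>\<^bsub>K G\<^esub> B"
  by (auto simp: mult_K)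

lemma bisection_carrier: "local_bisection G A \<Longrightarrow> a \<in> A \<Longrightarrow> a \<in> carrier G"
  by (auto simp: local_bisection_def)

lemma bisection_gdom: "local_bisection G A \<Longrightarrow> a \<in> A \<Longrightarrow> b \<in> A \<Longrightarrow> gdom G a = gdom G b \<Longrightarrow> a = b"
  and bisection_gran: "local_bisection G A \<Longrightarrow> a \<in> A \<Longrightarrow> b \<in> A \<Longrightarrow> gran G a = gran G b \<Longrightarrow> a = b"
  unfolding local_bisection_def by blast+

lemma bisection_subset: "local_bisection G A \<Longrightarrow> B \<subseteq> A \<Longrightarrow> local_bisection G B"
  by (auto simp: local_bisection_def)

lemma bisection_mult:
  assumes A: "local_bisection G A" and B: "local_bisection G B"
  shows "local_bisection G (A \<otimes>\<^bsub>K G\<^esub> B)"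
  unfolding local_bisection_def
proof (intro conjI ballI subsetI impI)
  fix x assume "x \<in> A \<otimes>\<^bsub>K G\<^esub> B"
  then obtain a b where x: "x = a \<cdot> b" "a \<in> A" "b \<in> B" "gdom G a = gran G b"
    by (auto simp: mult_K)
  then have c: "a \<in> carrier G" "b \<in> carrier G" using A B bisection_carrier by auto
  then show "x \<in> carrier G" using x by simp
  fix y assume "y \<in> A \<otimes>\<^bsub>K G\<^esub> B"
  then obtain a' b' where y: "y = a' \<cdot> b'" "a' \<in> A" "b' \<in> B" "gdom G a' = gran G b'"
    by (auto simp: mult_K)
  then have c': "a' \<in> carrier G" "b' \<in> carrier G" using A B bisection_carrier by auto
  show "x = y" if "gdom G x = gdom G y"
  proof -
    have "b = b'" by (rule bisection_gdom[OF B]) (use that x y c c' in auto)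
    moreover have "a = a'" by (rule bisection_gdom[OF A]) (use x y calculation in auto)
    ultimately show ?thesis using x y by simp
  qed
  show "x = y" if "gran G x = gran G y"
  proof -
    have "a = a'" by (rule bisection_gran[OF A]) (use that x y c c' in auto)
    moreover have "b = b'" by (rule bisection_gran[OF B]) (use x y calculation in auto)
    ultimately show ?thesis using x y by simp
  qed
qed

lemma mult_K_assoc:
  assumes "A \<subseteq> carrier G" "B \<subseteq> carrier G" "C \<subseteq> carrier G"
  shows "A \<otimes>\<^bsub>K G\<^esub> B \<otimes>\<^bsub>K G\<^esub> C = A \<otimes>\<^bsub>K G\<^esub> (B \<otimes>\<^bsub>K G\<^esub> C)"
proof (intro equalityI subsetI)
  fix x assume "x \<in> A \<otimes>\<^bsub>K G\<^esub> B \<otimes>\<^bsub>K G\<^esub> C"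
  then obtain a b c where x: "x = a \<cdot> b \<cdot> c" "a \<in> A" "b \<in> B" "c \<in> C"
      "gdom G a = gran G b" "gdom G (a \<cdot> b) = gran G c"
    by (auto simp: mult_K)
  then have "x = a \<cdot> (b \<cdot> c)" "gdom G b = gran G c" "gran G (b \<cdot> c) = gdom G a"
    using assms by (auto simp: gcomp_assoc subset_iff)
  then show "x \<in> A \<otimes>\<^bsub>K G\<^esub> (B \<otimes>\<^bsub>K G\<^esub> C)" using x by (auto intro!: mult_K_I)
next
  fix x assume "x \<in> A \<otimes>\<^bsub>K G\<^esub> (B \<otimes>\<^bsub>K G\<^esub> C)"
  then obtain a b c where x: "x = a \<cdot> (b \<cdot> c)" "a \<in> A" "b \<in> B" "c \<in> C"
      "gdom G a = gran G (b \<cdot> c)" "gdom G b = gran G c"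
    by (auto simp: mult_K)
  then have "x = a \<cdot> b \<cdot> c" "gdom G a = gran G b" "gdom G (a \<cdot> b) = gran G c"
    using assms by (auto simp: gcomp_assoc subset_iff)
  then show "x \<in> A \<otimes>\<^bsub>K G\<^esub> B \<otimes>\<^bsub>K G\<^esub> C" using x by (auto intro!: mult_K_I)
qed

lemma mult_units: "B \<subseteq> carrier G \<Longrightarrow> E \<subseteq> units \<Longrightarrow> B \<otimes>\<^bsub>K G\<^esub> E = {b \<in> B. gdom G b \<in> E}"
  and units_mult: "B \<subseteq> carrier G \<Longrightarrow> E \<subseteq> units \<Longrightarrow> E \<otimes>\<^bsub>K G\<^esub> B = {b \<in> B. gran G b \<in> E}"
proof -
  assume B: "B \<subseteq> carrier G" and E: "E \<subseteq> units"
  have u: "gdom G u = u" "gran G u = u" if "u \<in> E" for u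
    using unit_eq(1,2)[OF subsetD[OF E that]] by this+
  show "B \<otimes>\<^bsub>K G\<^esub> E = {b \<in> B. gdom G b \<in> E}"
    using B by (force simp: mult_K u subset_iff)
  show "E \<otimes>\<^bsub>K G\<^esub> B = {b \<in> B. gran G b \<in> E}"
    using B by (force simp: mult_K u subset_iff)
qed

lemma bisection_ginv:
  assumes "local_bisection G A"
  shows "local_bisection G (ginv G ` A)"
  using assms by (auto simp: local_bisection_def subset_iff)

lemma ginv_mult_K: "local_bisection G A \<Longrightarrow> ginv G ` A \<otimes>\<^bsub>K G\<^esub> A = gdom G ` A"
  and mult_ginv_K: "local_bisection G A \<Longrightarrow> A \<otimes>\<^bsub>K G\<^esub> ginv G ` A = gran G ` A"
proof -
  assume A: "local_bisection G A"
  then have c: "a \<in> carrier G" if "a \<in> A" for a using that bisection_carrier by auto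
  show "ginv G ` A \<otimes>\<^bsub>K G\<^esub> A = gdom G ` A"
  proof (intro equalityI subsetI)
    fix x assume "x \<in> ginv G ` A \<otimes>\<^bsub>K G\<^esub> A"
    then obtain a b where x: "x = ginv G a \<cdot> b" "a \<in> A" "b \<in> A" "gran G a = gran G b"
      using c by (auto simp: mult_K)
    then have "a = b" using bisection_gran A by blast
    then show "x \<in> gdom G ` A" using x by auto
  next
    fix x assume "x \<in> gdom G ` A"
    then obtain a where "x = ginv G a \<cdot> a" "a \<in> A" by auto
    then show "x \<in> ginv G ` A \<otimes>\<^bsub>K G\<^esub> A" using c by (auto simp del: ginv_gcomp intro!: mult_K_I)
  qed
  show "A \<otimes>\<^bsub>K G\<^esub> ginv G ` A = gran G ` A"
  proof (intro equalityI subsetI)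
    fix x assume "x \<in> A \<otimes>\<^bsub>K G\<^esub> ginv G ` A"
    then obtain a b where x: "x = a \<cdot> ginv G b" "a \<in> A" "b \<in> A" "gdom G a = gdom G b"
      using c by (auto simp: mult_K)
    then have "a = b" using bisection_gdom A by blast
    then show "x \<in> gran G ` A" using x by auto
  next
    fix x assume "x \<in> gran G ` A"
    then obtain a where "x = a \<cdot> ginv G a" "a \<in> A" by auto
    then show "x \<in> A \<otimes>\<^bsub>K G\<^esub> ginv G ` A" using c by (auto simp del: gcomp_ginv intro!: mult_K_I)
  qed
qed

lemma regular_K:
  assumes "local_bisection G A"
  shows "A \<otimes>\<^bsub>K G\<^esub> ginv G ` A \<otimes>\<^bsub>K G\<^esub> A = A"
proof -
  have c: "A \<subseteq> carrier G" using assms bisection_carrier by blast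
  then have "gran G ` A \<subseteq> units" by auto
  then show ?thesis using c by (auto simp: mult_ginv_K[OF assms] units_mult)
qed

text \<open>If \<open>A B A = A\<close>, an arrow \<open>a\<close> of \<open>A\<close> is \<open>a\<^sub>1 \<cdot> b \<cdot> a\<^sub>2\<close>; the arrows \<open>a\<^sub>1\<close> and \<open>a\<^sub>2\<close> of the local
  bisection \<open>A\<close> share the range and the domain of \<open>a\<close>, so both are \<open>a\<close>.\<close>

lemma ginv_subset_of_regular:
  assumes A: "local_bisection G A" and B: "local_bisection G B"
    and ABA: "A \<otimes>\<^bsub>K G\<^esub> B \<otimes>\<^bsub>K G\<^esub> A = A"
  shows "ginv G ` A \<subseteq> B"
proof clarify
  fix a assume a: "a \<in> A"
  then have "a \<in> A \<otimes>\<^bsub>K G\<^esub> B \<otimes>\<^bsub>K G\<^esub> A" using ABA by simp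
  then obtain a1 b a2 where *: "a = a1 \<cdot> b \<cdot> a2" "a1 \<in> A" "b \<in> B" "a2 \<in> A"
      "gdom G a1 = gran G b" "gdom G (a1 \<cdot> b) = gran G a2"
    by (auto simp: mult_K)
  have c: "a1 \<in> carrier G" "a2 \<in> carrier G" "b \<in> carrier G"
    using * A B bisection_carrier by auto
  have "gran G a = gran G (a1 \<cdot> b)" using * c by (simp only: gran_gcomp gcomp_closed)
  also have "\<dots> = gran G a1" using * c by simp
  finally have a1: "a1 = a" using * a by (metis bisection_gran[OF A])
  have "gdom G a = gdom G a2" using * c by (simp only: gdom_gcomp gcomp_closed)
  then have a2: "a2 = a" using * a by (metis bisection_gdom[OF A])
  have "b = ginv G a"
    using * c unfolding a1 a2 by (intro ginv_unique) simp_all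
  then show "ginv G a \<in> B" using * by simp
qed

lemma inverse_semigroup_K: "inverse_semigroup (K G)"
proof
  fix A B C
  assume A: "A \<in> carrier (K G)"
  { assume B: "B \<in> carrier (K G)"
    show "A \<otimes>\<^bsub>K G\<^esub> B \<in> carrier (K G)" using A B bisection_mult by simp
    assume "C \<in> carrier (K G)"
    then show "A \<otimes>\<^bsub>K G\<^esub> B \<otimes>\<^bsub>K G\<^esub> C = A \<otimes>\<^bsub>K G\<^esub> (B \<otimes>\<^bsub>K G\<^esub> C)" using A B
      by (intro mult_K_assoc) (auto simp: local_bisection_def) }
  have A: "local_bisection G A" using A by simp
  show "\<exists>!B. B \<in> carrier (K G) \<and> A \<otimes>\<^bsub>K G\<^esub> B \<otimes>\<^bsub>K G\<^esub> A = A \<and> B \<otimes>\<^bsub>K G\<^esub> A \<otimes>\<^bsub>K G\<^esub> B = B"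
  proof (rule ex1I[of _ "ginv G ` A"])
    have "ginv G ` ginv G ` A = A"
      using bisection_carrier[OF A] by (force simp: image_image)
    then show "ginv G ` A \<in> carrier (K G) \<and> A \<otimes>\<^bsub>K G\<^esub> ginv G ` A \<otimes>\<^bsub>K G\<^esub> A = A
        \<and> ginv G ` A \<otimes>\<^bsub>K G\<^esub> A \<otimes>\<^bsub>K G\<^esub> ginv G ` A = ginv G ` A"
      using regular_K[OF A] regular_K[OF bisection_ginv[OF A]] bisection_ginv[OF A] by simp
  next
    fix B assume "B \<in> carrier (K G) \<and> A \<otimes>\<^bsub>K G\<^esub> B \<otimes>\<^bsub>K G\<^esub> A = A \<and> B \<otimes>\<^bsub>K G\<^esub> A \<otimes>\<^bsub>K G\<^esub> B = B"
    then have B: "local_bisection G B" "A \<otimes>\<^bsub>K G\<^esub> B \<otimes>\<^bsub>K G\<^esub> A = A" "B \<otimes>\<^bsub>K G\<^esub> A \<otimes>\<^bsub>K G\<^esub> B = B" by auto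
    have 1: "ginv G ` A \<subseteq> B" using A B by (intro ginv_subset_of_regular)
    have "ginv G ` B \<subseteq> A" using A B by (intro ginv_subset_of_regular)
    then have "ginv G ` ginv G ` B \<subseteq> ginv G ` A" by blast
    moreover have "ginv G ` ginv G ` B = B"
      using bisection_carrier[OF B(1)] by (force simp: image_image)
    ultimately show "B = ginv G ` A" using 1 by blast
  qed
qed

interpretation KG: inverse_semigroup "K G"
  by (rule inverse_semigroup_K)

lemma sinv_K: "local_bisection G A \<Longrightarrow> sinv (K G) A = ginv G ` A"
proof -
  assume A: "local_bisection G A"
  have "ginv G ` ginv G ` A = A"
    using bisection_carrier[OF A] by (force simp: image_image)
  then show ?thesis
    using regular_K[OF A] regular_K[OF bisection_ginv[OF A]] bisection_ginv[OF A] A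
    by (intro KG.sinv_eqI) simp_all
qed

lemma sdom_K: "local_bisection G A \<Longrightarrow> sdom (K G) A = gdom G ` A"
  by (simp add: sdom_def sinv_K ginv_mult_K)

lemma nle_K:
  assumes A: "local_bisection G A" and B: "local_bisection G B"
  shows "A \<preceq>\<^bsub>K G\<^esub> B \<longleftrightarrow> A \<subseteq> B"
proof -
  have c: "A \<subseteq> carrier G" "B \<subseteq> carrier G" using A B by (auto simp: local_bisection_def)
  have "A \<preceq>\<^bsub>K G\<^esub> B \<longleftrightarrow> A = B \<otimes>\<^bsub>K G\<^esub> gdom G ` A"
    using KG.nle_iff_sdom[of A B] A B by (simp add: sdom_K)
  also have "\<dots> \<longleftrightarrow> A = {b \<in> B. gdom G b \<in> gdom G ` A}"
    using c by (subst mult_units) auto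
  also have "\<dots> \<longleftrightarrow> A \<subseteq> B"
  proof
    assume "A \<subseteq> B"
    then show "A = {b \<in> B. gdom G b \<in> gdom G ` A}"
      by (auto dest: bisection_gdom[OF B _ subsetD])
  qed blast
  finally show ?thesis .
qed

lemma units_bisection: "E \<subseteq> units \<Longrightarrow> local_bisection G E"
  unfolding local_bisection_def using unit_eq by (metis subset_iff)

lemma idempotents_K: "idempotents (K G) = Pow units"
proof (intro equalityI subsetI)
  fix A assume A: "A \<in> idempotents (K G)"
  then have "local_bisection G A" using KG.idem_closed[of A] by simp
  then have "sdom (K G) A = gdom G ` A" "A \<subseteq> carrier G"
    using sdom_K by (auto simp: local_bisection_def)
  then have "A = gdom G ` A" "gdom G ` A \<subseteq> units"
    using KG.sdom_of_idem[OF A] by (simp, intro image_mono)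
  then show "A \<in> Pow units" by (metis PowI)
next
  fix A assume A: "A \<in> Pow units"
  then have "local_bisection G A" using units_bisection by auto
  moreover have "A \<otimes>\<^bsub>K G\<^esub> A = A"
  proof -
    have c: "A \<subseteq> carrier G" using A by auto
    have u: "gdom G a = a" if "a \<in> A" for a using A that unit_eq[of a] by auto
    have "A \<otimes>\<^bsub>K G\<^esub> A = {a \<in> A. gdom G a \<in> A}" using A c by (intro mult_units) auto
    also have "\<dots> = A" using u by auto
    finally show ?thesis .
  qed
  ultimately show "A \<in> idempotents (K G)" using KG.idemI[of A] by simp
qed

text \<open>Two arrows \<open>a\<close>, \<open>b\<close> with the same range for which \<open>a\<^sup>-\<^sup>1 b\<close> is an identity are equal, and dually;
  so compatible local bisections have a local bisection as their union.\<close>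

lemma compatible_union:
  assumes A: "local_bisection G A" and B: "local_bisection G B" and AB: "compatible (K G) A B"
  shows "local_bisection G (A \<union> B)"
proof -
  have c: "a \<in> carrier G" if "a \<in> A \<union> B" for a
    using that A B bisection_carrier by auto
  have 1: "ginv G ` A \<otimes>\<^bsub>K G\<^esub> B \<subseteq> units" and 2: "A \<otimes>\<^bsub>K G\<^esub> ginv G ` B \<subseteq> units"
    using AB A B by (auto simp: compatible_def sinv_K idempotents_K)
  have ran: "a = b" if ab: "a \<in> A" "b \<in> B" "gran G a = gran G b" for a b
  proof -
    have "ginv G a \<cdot> b \<in> units" using 1 ab c by (auto intro!: subsetD[OF 1] mult_K_I)
    then have "ginv G a \<cdot> b = gran G (ginv G a \<cdot> b)" by (rule unit_eq(2)[symmetric])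
    also have "\<dots> = gdom G a" using ab c by simp
    finally have "a = a \<cdot> (ginv G a \<cdot> b)" using ab c by simp
    also have "\<dots> = a \<cdot> ginv G a \<cdot> b" using ab c by (intro gcomp_assoc[symmetric]) auto
    also have "\<dots> = b" using ab c by simp
    finally show ?thesis .
  qed
  have dom: "a = b" if ab: "a \<in> A" "b \<in> B" "gdom G a = gdom G b" for a b
  proof -
    have "a \<cdot> ginv G b \<in> units" using 2 ab c by (auto intro!: subsetD[OF 2] mult_K_I)
    then have "a \<cdot> ginv G b = gdom G (a \<cdot> ginv G b)" by (rule unit_eq(1)[symmetric])
    also have "\<dots> = gran G b" using ab c by simp
    finally have "b = a \<cdot> ginv G b \<cdot> b" using ab c by simp
    also have "\<dots> = a \<cdot> (ginv G b \<cdot> b)" using ab c by (intro gcomp_assoc) auto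
    also have "\<dots> = a" using ab c by simp (metis UnCI gcomp_gdom)
    finally show ?thesis by simp
  qed
  show ?thesis
    unfolding local_bisection_def
    using c ran dom bisection_gdom[OF A] bisection_gran[OF A] bisection_gdom[OF B] bisection_gran[OF B]
    by (metis Un_iff subsetI)
qed

lemma lub_K_Union:
  assumes "local_bisection G (\<Union>\<X>)"
  shows "lub (K G) \<X> (\<Union>\<X>)"
  unfolding lub_def
proof (intro conjI ballI impI)
  have X: "local_bisection G A" if "A \<in> \<X>" for A
    using assms that by (auto intro: bisection_subset)
  show "A \<preceq>\<^bsub>K G\<^esub> \<Union>\<X>" if "A \<in> \<X>" for A
    using X assms that by (auto simp: nle_K)
  show "\<Union>\<X> \<preceq>\<^bsub>K G\<^esub> U" if "U \<in> carrier (K G)" "\<forall>A\<in>\<X>. A \<preceq>\<^bsub>K G\<^esub> U" for U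
    using X assms that by (auto simp: nle_K)
qed (use assms in simp)

lemma is_join_K_iff:
  assumes A: "local_bisection G A" and B: "local_bisection G B" and AB: "compatible (K G) A B"
  shows "is_join (K G) J A B \<longleftrightarrow> J = A \<union> B"
proof -
  have "lub (K G) {A, B} (A \<union> B)"
    using lub_K_Union[of "{A, B}"] compatible_union[OF assms] by simp
  then have "lub (K G) {A, B} J \<longleftrightarrow> J = A \<union> B" by (metis KG.lub_unique)
  then show ?thesis using A B by (simp add: is_join_iff_lub)
qed

lemma is_zero_K_iff: "is_zero (K G) Z \<longleftrightarrow> Z = {}"
proof -
  have "is_zero (K G) {}" by (auto simp: is_zero_def local_bisection_def mult_K)
  then show ?thesis using is_zero_unique by metis
qed

theorem boolean_inverse_semigroup_K: "boolean_inverse_semigroup (K G)"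
proof (intro boolean_inverse_semigroup.intro boolean_inverse_semigroup_axioms.intro
    distributive_inverse_semigroup.intro distributive_inverse_semigroup_axioms.intro)
  show "inverse_semigroup (K G)" by (rule inverse_semigroup_K)
next
  show "has_zero (K G)" by (auto simp: has_zero_def is_zero_K_iff)
next
  fix A B assume "A \<in> carrier (K G)" "B \<in> carrier (K G)" "compatible (K G) A B"
  then show "\<exists>J. is_join (K G) J A B" by (auto simp: is_join_K_iff)
next
  fix A B C J
  assume "A \<in> carrier (K G)" "B \<in> carrier (K G)" "C \<in> carrier (K G)"
    and AB: "compatible (K G) A B" "is_join (K G) J A B"
  then have c: "local_bisection G A" "local_bisection G B" "local_bisection G C" by auto
  have J: "local_bisection G (A \<union> B)" "J = A \<union> B"
    using compatible_union AB c is_join_K_iff by auto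
  have "C \<otimes>\<^bsub>K G\<^esub> J = \<Union>{C \<otimes>\<^bsub>K G\<^esub> A, C \<otimes>\<^bsub>K G\<^esub> B}" "J \<otimes>\<^bsub>K G\<^esub> C = \<Union>{A \<otimes>\<^bsub>K G\<^esub> C, B \<otimes>\<^bsub>K G\<^esub> C}"
    by (auto simp: mult_K J)
  then show "is_join (K G) (C \<otimes>\<^bsub>K G\<^esub> J) (C \<otimes>\<^bsub>K G\<^esub> A) (C \<otimes>\<^bsub>K G\<^esub> B)"
    "is_join (K G) (J \<otimes>\<^bsub>K G\<^esub> C) (A \<otimes>\<^bsub>K G\<^esub> C) (B \<otimes>\<^bsub>K G\<^esub> C)"
    using lub_K_Union[of "{C \<otimes>\<^bsub>K G\<^esub> A, C \<otimes>\<^bsub>K G\<^esub> B}"] lub_K_Union[of "{A \<otimes>\<^bsub>K G\<^esub> C, B \<otimes>\<^bsub>K G\<^esub> C}"]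
      bisection_mult[OF c(3) J(1)] bisection_mult[OF J(1) c(3)] c J(2)
    by (simp_all add: is_join_iff_lub bisection_mult)
next
  show "generalized_boolean_algebra ((natural_order (K G))\<lparr>carrier := idempotents (K G)\<rparr>)"
  proof (rule powerset_generalized_boolean_algebra[of _ units])
    fix A B assume "A \<subseteq> units" "B \<subseteq> units"
    then show "le ((natural_order (K G))\<lparr>carrier := idempotents (K G)\<rparr>) A B \<longleftrightarrow> A \<subseteq> B"
      using nle_K[of A B] units_bisection by (simp add: natural_order_def nle_def)
  qed (simp_all add: natural_order_def idempotents_K)
qed

lemma monoid_K: "monoid (K G)"
proof
  fix A assume A: "A \<in> carrier (K G)"
  then have "A \<subseteq> carrier G" by (auto simp: local_bisection_def)
  then show "\<one>\<^bsub>K G\<^esub> \<otimes>\<^bsub>K G\<^esub> A = A" "A \<otimes>\<^bsub>K G\<^esub> \<one>\<^bsub>K G\<^esub> = A"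
    by (auto simp: mult_units units_mult)
next
  show "\<one>\<^bsub>K G\<^esub> \<in> carrier (K G)" using units_bisection by simp
qed (use KG.m_closed KG.m_assoc in auto)

end

section \<open>The restricted groupoid\<close>

lemma (in inverse_semigroup) is_zero_of_sdom:
  assumes "a \<in> carrier S" "is_zero S (sdom S a)"
  shows "is_zero S a"
  using assms mult_zero[OF assms(2,1)] by (simp add: mult_sdom[OF assms(1)])

text \<open>The zero can be left out, as a restricted product of nonzero elements has the domain of its
  second factor and so is nonzero.\<close>

lemma (in inverse_semigroup) groupoid_laws_restricted: "groupoid_laws (restricted_groupoid S)"
proof -
  let ?G = "restricted_groupoid S"
  have C: "x \<in> carrier ?G \<longleftrightarrow> x \<in> carrier S \<and> \<not> is_zero S x" for x
    by (simp add: restricted_groupoid_def)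
  have d [simp]: "gdom ?G x = sdom S x" and r [simp]: "gran ?G x = sran S x" if "x \<in> carrier S" for x
    using that by (simp_all add: gdom_def gran_def restricted_groupoid_def) (simp_all add: sdom_def sran_def)
  have i [simp]: "ginv ?G = sinv S" by (simp add: restricted_groupoid_def)
  have m: "the (gcomp ?G x y) = x \<otimes> y" if "sdom S x = sran S y" for x y
    using that by (simp add: restricted_groupoid_def)
  have zi: "\<not> is_zero S (sinv S x)" if "x \<in> carrier S" "\<not> is_zero S x" for x
    using that by (metis sinv_sinv sinv_idem zero_idem)
  have zd: "\<not> is_zero S (sdom S x)" if "x \<in> carrier S" "\<not> is_zero S x" for x
    using that is_zero_of_sdom by blast
  have zm: "\<not> is_zero S (x \<otimes> y)"
    if "x \<in> carrier S" "y \<in> carrier S" "\<not> is_zero S y" "sdom S x = sran S y" for x y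
  proof
    assume "is_zero S (x \<otimes> y)"
    then have "is_zero S (sdom S (x \<otimes> y))" by simp
    then show False using that zd sdom_mult_of_composable(1)[of x y] by simp
  qed
  show ?thesis
    by unfold_locales (auto simp: C m sdom_mult_of_composable zi zd zm)
qed

section \<open>Finite joins in Boolean inverse semigroups\<close>

definition szero :: "('a, 'm) monoid_scheme \<Rightarrow> 'a" where
  "szero S = (THE z. is_zero S z)"

context inverse_semigroup
begin

lemma compatible_of_nle:
  assumes "a \<preceq> c" "b \<preceq> c" "a \<in> carrier S" "b \<in> carrier S" "c \<in> carrier S"
  shows "compatible S a b"
proof -
  obtain e f where e: "e \<in> idempotents S" "a = c \<otimes> e" and f: "f \<in> idempotents S" "b = c \<otimes> f"
    using assms by (auto simp: nle_iff_mult_idem)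
  obtain e' f' where e': "e' \<in> idempotents S" "a = e' \<otimes> c" and f': "f' \<in> idempotents S" "b = f' \<otimes> c"
    using assms by (auto simp: nle_iff_idem_mult)
  have "sinv S a \<otimes> b = e \<otimes> (sdom S c \<otimes> f)"
    unfolding e(2) f(2) using e(1) f(1) assms(5) by (simp add: sinv_mult sdom_def)
  moreover have "a \<otimes> sinv S b = e' \<otimes> (sran S c \<otimes> f')"
    unfolding e'(2) f'(2) using e'(1) f'(1) assms(5) by (simp add: sinv_mult sran_def)
  ultimately show ?thesis
    unfolding compatible_def using e(1) f(1) e'(1) f'(1) assms(5) by (simp only: idem_mult sdom_idem sran_idem)
qed

lemma nle_iff_sran:
  assumes "a \<in> carrier S" "b \<in> carrier S"
  shows "a \<preceq> b \<longleftrightarrow> a = sran S a \<otimes> b"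
proof
  assume "a \<preceq> b"
  then obtain e where e: "e \<in> idempotents S" "a = e \<otimes> b" using nle_iff_idem_mult assms by auto
  have c: "e \<in> carrier S" using e by simp
  have "e \<otimes> a = a" using e assms by simp
  then have "e \<otimes> sran S a = sran S a"
    using assms c m_assoc[of e a "sinv S a"] by (simp add: sran_def)
  then have "sran S a \<otimes> b = sran S a \<otimes> (e \<otimes> b)"
    using e(1) assms c idem_commute[OF e(1) sran_idem[OF assms(1)]] by (simp flip: m_assoc)
  also have "\<dots> = a" using e assms by (metis sran_mult)
  finally show "a = sran S a \<otimes> b" by (rule sym)
next
  assume "a = sran S a \<otimes> b"
  then show "a \<preceq> b" using assms sran_idem nle_iff_idem_mult by blast
qed

lemma lub_closed: "lub S X j \<Longrightarrow> j \<in> carrier S"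
  and lub_upper: "lub S X j \<Longrightarrow> x \<in> X \<Longrightarrow> x \<preceq> j"
  and lub_least: "lub S X j \<Longrightarrow> u \<in> carrier S \<Longrightarrow> (\<And>x. x \<in> X \<Longrightarrow> x \<preceq> u) \<Longrightarrow> j \<preceq> u"
  by (auto simp: lub_def)

lemma lubI:
  assumes "j \<in> carrier S" "\<And>x. x \<in> X \<Longrightarrow> x \<preceq> j"
    "\<And>u. u \<in> carrier S \<Longrightarrow> (\<And>x. x \<in> X \<Longrightarrow> x \<preceq> u) \<Longrightarrow> j \<preceq> u"
  shows "lub S X j"
  using assms by (auto simp: lub_def)

lemma lub_singleton: "x \<in> carrier S \<Longrightarrow> lub S {x} x"
  by (rule lubI) auto

text \<open>A least upper bound may be computed in stages.\<close>

lemma lub_UNION_iff: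
  assumes X: "\<And>i. i \<in> I \<Longrightarrow> X i \<subseteq> carrier S" and j: "\<And>i. i \<in> I \<Longrightarrow> lub S (X i) (j i)"
  shows "lub S (\<Union>i\<in>I. X i) k \<longleftrightarrow> lub S (j ` I) k"
proof -
  have "(\<forall>x\<in>\<Union>i\<in>I. X i. x \<preceq> u) \<longleftrightarrow> (\<forall>y\<in>j ` I. y \<preceq> u)" if u: "u \<in> carrier S" for u
  proof -
    have "(\<forall>x\<in>X i. x \<preceq> u) \<longleftrightarrow> j i \<preceq> u" if i: "i \<in> I" for i
    proof
      assume "\<forall>x\<in>X i. x \<preceq> u"
      then show "j i \<preceq> u" using lub_least[OF j[OF i] u] by blast
    next
      assume ju: "j i \<preceq> u"
      show "\<forall>x\<in>X i. x \<preceq> u"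
      proof
        fix x assume x: "x \<in> X i"
        show "x \<preceq> u"
          using lub_upper[OF j[OF i] x] ju lub_closed[OF j[OF i]] X[OF i] x u by (blast intro: nle_trans)
      qed
    qed
    then show ?thesis by blast
  qed
  then show ?thesis unfolding lub_def by auto
qed

text \<open>This lemma and the next are the case of two stages, indexed by the truth values.\<close>

lemma lub_insert:
  assumes "lub S X j" "lub S {x, j} k" "X \<subseteq> carrier S" "x \<in> carrier S"
  shows "lub S (insert x X) k"
proof -
  have "lub S (\<Union>b\<in>UNIV. if b then {x} else X) k \<longleftrightarrow> lub S ((\<lambda>b. if b then x else j) ` UNIV) k"
    using assms by (intro lub_UNION_iff) (auto simp: lub_singleton split: if_splits)
  then show ?thesis using assms(2) by (simp add: UNIV_bool insert_commute)
qed

lemma lub_pair: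
  assumes "lub S X x" "lub S Y y" "lub S (X \<union> Y) k" "X \<subseteq> carrier S" "Y \<subseteq> carrier S"
  shows "lub S {x, y} k"
proof -
  have "lub S (\<Union>b\<in>UNIV. if b then X else Y) k \<longleftrightarrow> lub S ((\<lambda>b. if b then x else y) ` UNIV) k"
    using assms by (intro lub_UNION_iff) (auto split: if_splits)
  then show ?thesis using assms(3) by (simp add: UNIV_bool insert_commute Un_commute)
qed

lemma lub_insert_zero: "is_zero S z \<Longrightarrow> lub S (insert z X) j \<longleftrightarrow> lub S X j"
  by (auto simp: lub_def)

lemma lub_cong_zero:
  assumes "is_zero S z" "insert z X = insert z Y"
  shows "lub S X j \<longleftrightarrow> lub S Y j"
  using assms lub_insert_zero by metis

lemma szero_eq: "is_zero S z \<Longrightarrow> szero S = z"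
  unfolding szero_def using is_zero_unique by (intro the_equality) auto

end

context distributive_inverse_semigroup
begin

lemma is_zero_szero [simp]: "is_zero S (szero S)"
  using zero_exists szero_eq by (auto simp: has_zero_def)

lemma lub_empty: "lub S {} (szero S)"
  by (rule lubI) auto

text \<open>Induction on the finite set. The join \<open>j\<close> of the elements already treated stays
  compatible with the next element \<open>x\<close>: as multiplication distributes over \<open>j\<close>, the products
  \<open>sinv S x \<otimes> j\<close> and \<open>j \<otimes> sinv S x\<close> are joins of idempotents. So the distributive law has
  to be part of the induction hypothesis.\<close>

lemma finite_compatible_join:
  assumes "finite X" "X \<subseteq> carrier S" "pairwise (compatible S) X"
  shows "\<exists>j. lub S X j \<and> (\<forall>c\<in>carrier S.
    lub S ((\<lambda>x. c \<otimes> x) ` X) (c \<otimes> j) \<and> lub S ((\<lambda>x. x \<otimes> c) ` X) (j \<otimes> c))"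
  using assms
proof (induction X)
  case empty
  show ?case by (intro exI[of _ "szero S"]) (auto simp: lub_empty)
next
  case (insert x X)
  obtain j where j: "lub S X j"
    and dl: "\<And>c. c \<in> carrier S \<Longrightarrow> lub S ((\<lambda>x. c \<otimes> x) ` X) (c \<otimes> j)"
    and dr: "\<And>c. c \<in> carrier S \<Longrightarrow> lub S ((\<lambda>x. x \<otimes> c) ` X) (j \<otimes> c)"
    using insert by (auto simp: pairwise_insert)
  have c: "x \<in> carrier S" "X \<subseteq> carrier S" "j \<in> carrier S" using insert.prems j lub_closed by auto
  have comp: "compatible S x y" "compatible S y x" if "y \<in> X" for y
    using insert.prems(2) insert.hyps(2) that by (auto simp: pairwise_insert)
  have "sinv S x \<otimes> j \<in> idempotents S"
    using dl[of "sinv S x"] c comp by (intro lub_idem) (auto simp: compatible_def)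
  moreover have "j \<otimes> sinv S x \<in> idempotents S"
    using dr[of "sinv S x"] c comp by (intro lub_idem) (auto simp: compatible_def)
  then have "sinv S (j \<otimes> sinv S x) \<in> idempotents S" by simp
  then have "x \<otimes> sinv S j \<in> idempotents S" using c by (simp add: sinv_mult)
  ultimately have xj: "compatible S x j" by (simp add: compatible_def)
  then obtain k where k: "is_join S k x j" using compatible_join_exists c by blast
  have "lub S (insert x X) k" using k j c by (intro lub_insert[OF j]) (auto simp: is_join_iff_lub)
  moreover have "lub S ((\<lambda>x. d \<otimes> x) ` insert x X) (d \<otimes> k)" if d: "d \<in> carrier S" for d
    proof -
    show ?thesis
      using mult_join_distrib_left[OF c(1,3) d xj k] c d unfolding image_insert
      by (intro lub_insert[OF dl[OF d]]) (auto simp: is_join_iff_lub)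
  qed
  moreover have "lub S ((\<lambda>x. x \<otimes> d) ` insert x X) (k \<otimes> d)" if d: "d \<in> carrier S" for d
    proof -
    show ?thesis
      using mult_join_distrib_right[OF c(1,3) d xj k] c d unfolding image_insert
      by (intro lub_insert[OF dr[OF d]]) (auto simp: is_join_iff_lub)
  qed
  ultimately show ?case by blast
qed

lemma lub_mult:
  assumes "lub S X j" "finite X" "X \<subseteq> carrier S" "pairwise (compatible S) X" "c \<in> carrier S"
  shows "lub S ((\<lambda>x. c \<otimes> x) ` X) (c \<otimes> j)" "lub S ((\<lambda>x. x \<otimes> c) ` X) (j \<otimes> c)"
  using finite_compatible_join[OF assms(2-4)] assms(1,5) lub_unique by blast+

lemma lub_mult_lub:
  assumes X: "lub S X x" "finite X" "X \<subseteq> carrier S" "pairwise (compatible S) X"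
    and Y: "lub S Y y" "finite Y" "Y \<subseteq> carrier S" "pairwise (compatible S) Y"
  shows "lub S {a \<otimes> b | a b. a \<in> X \<and> b \<in> Y} (x \<otimes> y)"
proof -
  have y: "y \<in> carrier S" using Y lub_closed by auto
  have "lub S (\<Union>a\<in>X. (\<lambda>b. a \<otimes> b) ` Y) (x \<otimes> y) \<longleftrightarrow> lub S ((\<lambda>a. a \<otimes> y) ` X) (x \<otimes> y)"
    using X(3) Y(3) lub_mult(1)[OF Y] by (intro lub_UNION_iff) (auto simp: subset_iff)
  moreover have "(\<Union>a\<in>X. (\<lambda>b. a \<otimes> b) ` Y) = {a \<otimes> b | a b. a \<in> X \<and> b \<in> Y}" by auto
  ultimately show ?thesis using lub_mult(2)[OF X y] by simp
qed

lemma pairwise_compatible_idem: "X \<subseteq> idempotents S \<Longrightarrow> pairwise (compatible S) X"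
  by (auto simp: pairwise_def intro: compatible_idem)

end

context boolean_inverse_semigroup
begin

text \<open>The complement, in the principal ideal of \<open>e\<close>, of the join of \<open>F\<close>.\<close>

lemma relative_complement:
  assumes F: "finite F" "F \<subseteq> idempotents S" and e: "e \<in> idempotents S" and le: "\<And>f. f \<in> F \<Longrightarrow> f \<preceq> e"
  shows "\<exists>c\<in>idempotents S. lub S (insert c F) e \<and> (\<forall>f\<in>F. c \<otimes> f = szero S)"
proof -
  have FC: "F \<subseteq> carrier S" using F by auto
  obtain j where j: "lub S F j"
    using finite_compatible_join[OF F(1) FC pairwise_compatible_idem[OF F(2)]] by blast
  have ji: "j \<in> idempotents S" using lub_idem[OF j F(2)] .
  have je: "j \<preceq> e" using lub_least[OF j, of e] le e by simp
  define P where "P = principal_ideal ((natural_order S)\<lparr>carrier := idempotents S\<rparr>) e"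
  have cP: "carrier P = {f \<in> idempotents S. f \<preceq> e}"
    and leP: "le P a b \<longleftrightarrow> a \<preceq> b" for a b
    by (auto simp: P_def principal_ideal_def natural_order_def nle_def)
  interpret P: unital_boolean_algebra P
    unfolding P_def using e
    by (intro generalized_boolean_algebra.principal_ideal_boolean[OF idempotents_boolean]) simp
  have jP: "j \<in> carrier P" using ji je by (simp add: cP)
  obtain c where c: "c \<in> carrier P" "meet P j c = bottom P" "join P j c = top P"
    using P.complement_exists[OF jP] by blast
  have ci: "c \<in> idempotents S" "c \<preceq> e" using c by (auto simp: cP)
  have zP: "szero S \<in> carrier P" using e by (simp add: cP)
  have cj: "c \<otimes> j \<in> carrier P"
    using ci ji e mult_idem_nle[of c j] nle_trans[of "c \<otimes> j" c e] by (simp add: cP)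
  have "le P (c \<otimes> j) (meet P j c)"
    using cj jP c(1) ci(1) ji mult_idem_nle[of c j] idem_mult_nle[of j c]
    by (intro P.meet_le) (auto simp: leP)
  also have "le P (meet P j c) (szero S)" using zP by (simp add: c)
  finally have "c \<otimes> j \<preceq> szero S" using cj zP c jP by (simp add: leP)
  then have cj0: "c \<otimes> j = szero S" using nle_zero ci ji by simp
  have "c \<otimes> f = szero S" if f: "f \<in> F" for f
  proof -
    have "c \<otimes> f \<preceq> c \<otimes> j" using lub_upper[OF j f] f FC ci ji by (intro nle_mult) auto
    then show ?thesis unfolding cj0 using nle_zero f FC ci by auto
  qed
  moreover have "lub S {c, j} e"
  proof -
    obtain w where w: "lub S {c, j} w"
      using compatible_join_exists[of c j] compatible_idem ci ji by (auto simp: is_join_iff_lub)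
    have wi: "w \<in> idempotents S" using lub_idem[OF w] ci ji by simp
    have we: "w \<preceq> e" using lub_least[OF w, of e] ci je e by auto
    have wP: "w \<in> carrier P" using wi we by (simp add: cP)
    have eP: "e \<in> carrier P" using e by (simp add: cP)
    have "le P (join P j c) w" using wP jP c(1) lub_upper[OF w]
      by (intro P.join_le) (auto simp: leP)
    then have "le P (top P) w" by (simp add: c)
    moreover have "le P e (top P)" using eP by simp
    ultimately have "le P e w" using P.le_trans eP wP P.top_closed by blast
    then have "e \<preceq> w" by (simp add: leP)
    then have "w = e" using nle_antisym we wi e by simp
    then show ?thesis using w by simp
  qed
  then have "lub S (insert c F) e" using lub_insert[OF j] FC ci by simp
  ultimately show ?thesis using ci by blast
qed

end

section \<open>Homomorphisms of inverse semigroups\<close>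

context
  fixes S (structure) and T (structure) and h
  assumes S: "inverse_semigroup S" and T: "inverse_semigroup T" and h: "h \<in> hom S T"
begin

interpretation S: inverse_semigroup S by (rule S)
interpretation T: inverse_semigroup T by (rule T)

lemma hom_sinv: "a \<in> carrier S \<Longrightarrow> h (sinv S a) = sinv T (h a)"
proof (rule T.sinv_eqI[symmetric])
  assume a: "a \<in> carrier S"
  show "h a \<in> carrier T" "h (sinv S a) \<in> carrier T" using a hom_in_carrier[OF h] by auto
  show "h a \<otimes>\<^bsub>T\<^esub> h (sinv S a) \<otimes>\<^bsub>T\<^esub> h a = h a"
    "h (sinv S a) \<otimes>\<^bsub>T\<^esub> h a \<otimes>\<^bsub>T\<^esub> h (sinv S a) = h (sinv S a)"
    using a by (simp_all flip: hom_mult[OF h])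
qed

lemma hom_idem: "e \<in> idempotents S \<Longrightarrow> h e \<in> idempotents T"
proof (rule T.idemI)
  assume e: "e \<in> idempotents S"
  show "h e \<in> carrier T" using e hom_in_carrier[OF h] by simp
  show "h e \<otimes>\<^bsub>T\<^esub> h e = h e" using hom_mult[OF h, of e e] e by simp
qed

lemma hom_nle: "a \<preceq>\<^bsub>S\<^esub> b \<Longrightarrow> a \<in> carrier S \<Longrightarrow> b \<in> carrier S \<Longrightarrow> h a \<preceq>\<^bsub>T\<^esub> h b"
  using hom_in_carrier[OF h] hom_idem hom_mult[OF h]
  by (auto simp: S.nle_iff_mult_idem T.nle_iff_mult_idem)

lemma hom_compatible:
  assumes "compatible S a b" "a \<in> carrier S" "b \<in> carrier S"
  shows "compatible T (h a) (h b)"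
proof -
  have "sinv T (h a) \<otimes>\<^bsub>T\<^esub> h b = h (sinv S a \<otimes>\<^bsub>S\<^esub> b)" "h a \<otimes>\<^bsub>T\<^esub> sinv T (h b) = h (a \<otimes>\<^bsub>S\<^esub> sinv S b)"
    using assms by (simp_all add: hom_mult[OF h] hom_sinv)
  then show ?thesis using assms hom_idem by (simp add: compatible_def)
qed

end

section \<open>The homomorphism from an inverse semigroup to its local bisections\<close>

definition principal_bisection :: "('a, 'm) monoid_scheme \<Rightarrow> 'a \<Rightarrow> 'a set" where
  "principal_bisection S s = {t \<in> carrier S. t \<preceq>\<^bsub>S\<^esub> s \<and> \<not> is_zero S t}"

context inverse_semigroup
begin

sublocale RG: groupoid_laws "restricted_groupoid S"
  by (rule groupoid_laws_restricted)

abbreviation KS :: "'a set monoid" where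
  "KS \<equiv> K (restricted_groupoid S)"

lemma restricted_carrier: "x \<in> carrier (restricted_groupoid S) \<longleftrightarrow> x \<in> carrier S \<and> \<not> is_zero S x"
  by (simp add: restricted_groupoid_def)

lemma restricted_gdom: "x \<in> carrier S \<Longrightarrow> gdom (restricted_groupoid S) x = sdom S x"
  and restricted_gran: "x \<in> carrier S \<Longrightarrow> gran (restricted_groupoid S) x = sran S x"
  by (simp_all add: gdom_def gran_def restricted_groupoid_def) (simp_all add: sdom_def sran_def)

lemma bisection_iff: "local_bisection (restricted_groupoid S) A \<longleftrightarrow>
    A \<subseteq> {x \<in> carrier S. \<not> is_zero S x} \<and> inj_on (sdom S) A \<and> inj_on (sran S) A"
proof -
  have "(\<forall>a\<in>A. \<forall>b\<in>A. (gdom (restricted_groupoid S) a = gdom (restricted_groupoid S) b \<longrightarrow> a = b)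
      \<and> (gran (restricted_groupoid S) a = gran (restricted_groupoid S) b \<longrightarrow> a = b))
    \<longleftrightarrow> inj_on (sdom S) A \<and> inj_on (sran S) A" if "A \<subseteq> carrier S"
    unfolding inj_on_def using restricted_gdom[OF subsetD[OF that]] restricted_gran[OF subsetD[OF that]] by auto
  moreover have "A \<subseteq> carrier (restricted_groupoid S) \<longleftrightarrow> A \<subseteq> {x \<in> carrier S. \<not> is_zero S x}"
    using restricted_carrier by auto
  ultimately show ?thesis unfolding local_bisection_def by blast
qed

lemma KS_mult:
  assumes "A \<subseteq> carrier S" "B \<subseteq> carrier S"
  shows "A \<otimes>\<^bsub>KS\<^esub> B = {a \<otimes> b | a b. a \<in> A \<and> b \<in> B \<and> sdom S a = sran S b}"
proof -
  have m: "the (gcomp (restricted_groupoid S) a b) = a \<otimes> b" if "sdom S a = sran S b" for a b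
    using that by (simp add: restricted_groupoid_def)
  have d: "gdom (restricted_groupoid S) a = sdom S a" if "a \<in> A" for a
    using that assms restricted_gdom by auto
  have r: "gran (restricted_groupoid S) b = sran S b" if "b \<in> B" for b
    using that assms restricted_gran by auto
  show ?thesis
    unfolding RG.mult_K using m d r by (intro Collect_cong ex_cong1) (metis)
qed

lemma bisection_carrier_S: "local_bisection (restricted_groupoid S) A \<Longrightarrow> A \<subseteq> carrier S"
  by (auto simp: bisection_iff)

text \<open>An element below \<open>s\<close> is the restriction of \<open>s\<close> to its domain, and also to its range, so
  either of them determines it.\<close>

lemma principal_bisection_bisection:
  assumes "s \<in> carrier S"
  shows "local_bisection (restricted_groupoid S) (principal_bisection S s)"
proof -
  have "t = s \<otimes> sdom S t" "t = sran S t \<otimes> s" if "t \<in> principal_bisection S s" for t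
    using that assms nle_iff_sdom[of t s] nle_iff_sran[of t s] by (auto simp: principal_bisection_def)
  then have "inj_on (sdom S) (principal_bisection S s)" "inj_on (sran S) (principal_bisection S s)"
    by (metis inj_onI)+
  then show ?thesis by (auto simp: bisection_iff principal_bisection_def)
qed

lemma principal_bisection_carrier: "principal_bisection S s \<subseteq> carrier S"
  by (auto simp: principal_bisection_def)

lemma principal_bisection_zero: "is_zero S z \<Longrightarrow> principal_bisection S z = {}"
  using nle_zero by (auto simp: principal_bisection_def)

text \<open>An element below \<open>s \<otimes> s'\<close> factorizes as a restricted product of elements
  below \<open>s\<close> and \<open>s'\<close>: restrict \<open>s'\<close> to the domain of the element, and \<open>s\<close> to the range of that.\<close>

lemma nle_mult_factor:
  assumes u: "u \<in> carrier S" "u \<preceq> s \<otimes> s'" and s: "s \<in> carrier S" "s' \<in> carrier S"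
  shows "\<exists>t t'. t \<in> carrier S \<and> t' \<in> carrier S \<and> t \<preceq> s \<and> t' \<preceq> s' \<and> sdom S t = sran S t' \<and> u = t \<otimes> t'"
proof -
  define t' where "t' = s' \<otimes> sdom S u"
  define t where "t = s \<otimes> sran S t'"
  have c: "t' \<in> carrier S" "t \<in> carrier S" using u s by (simp_all add: t'_def t_def)
  have ust: "u = s \<otimes> t'"
    using nle_iff_sdom[of u "s \<otimes> s'"] u s by (simp add: t'_def)
  have "sdom S u = sinv S t' \<otimes> (sdom S s \<otimes> t')"
    using c s by (simp add: ust sdom_def sinv_mult)
  moreover have "t' \<otimes> sdom S u = t'" using u s by (simp add: t'_def)
  ultimately have "t' = t' \<otimes> (sinv S t' \<otimes> (sdom S s \<otimes> t'))" by simp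
  then have "sran S t' = t' \<otimes> (sinv S t' \<otimes> (sdom S s \<otimes> t')) \<otimes> sinv S t'" by (simp add: sran_def)
  also have "\<dots> = sran S t' \<otimes> (sdom S s \<otimes> sran S t')" using c s by (simp add: sran_def)
  also have "\<dots> = sran S t' \<otimes> (sran S t' \<otimes> sdom S s)" using c s idem_commute by simp
  also have "\<dots> = sran S t' \<otimes> sdom S s" using c s by simp
  also have "\<dots> = sdom S s \<otimes> sran S t'" using c s by (intro idem_commute) auto
  finally have r: "sran S t' = sdom S s \<otimes> sran S t'" .
  have "sdom S t = sran S t' \<otimes> (sdom S s \<otimes> sran S t')"
    using c(1) s by (simp add: t_def sdom_def[of S "s \<otimes> _"] sinv_mult) (simp add: sdom_def)
  then have "sdom S t = sran S t'" using r c by simp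
  moreover have "u = t \<otimes> t'" using c s by (simp add: ust t_def)
  moreover have "t \<preceq> s" "t' \<preceq> s'"
    using c s u unfolding t_def t'_def by (auto intro: mult_idem_nle)
  ultimately show ?thesis using c by blast
qed

lemma principal_bisection_mult:
  assumes s: "s \<in> carrier S" "s' \<in> carrier S"
  shows "principal_bisection S (s \<otimes> s') = principal_bisection S s \<otimes>\<^bsub>KS\<^esub> principal_bisection S s'"
proof (intro equalityI subsetI)
  fix u assume "u \<in> principal_bisection S (s \<otimes> s')"
  then have u: "u \<in> carrier S" "u \<preceq> s \<otimes> s'" "\<not> is_zero S u" by (auto simp: principal_bisection_def)
  obtain t t' where t: "t \<in> carrier S" "t' \<in> carrier S" "t \<preceq> s" "t' \<preceq> s'" "sdom S t = sran S t'" "u = t \<otimes> t'"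
    using nle_mult_factor[OF u(1,2) s] by blast
  have "\<not> is_zero S t" using u(3) t zero_mult[of t t'] by metis
  moreover have "\<not> is_zero S t'" using u(3) t mult_zero[of t' t] by metis
  ultimately show "u \<in> principal_bisection S s \<otimes>\<^bsub>KS\<^esub> principal_bisection S s'"
    unfolding KS_mult[OF principal_bisection_carrier principal_bisection_carrier]
    using t by (auto simp: principal_bisection_def)
next
  fix u assume "u \<in> principal_bisection S s \<otimes>\<^bsub>KS\<^esub> principal_bisection S s'"
  then obtain t t' where t: "t \<in> principal_bisection S s" "t' \<in> principal_bisection S s'"
      "sdom S t = sran S t'" "u = t \<otimes> t'"
    unfolding KS_mult[OF principal_bisection_carrier principal_bisection_carrier] by blast
  have m: "u \<in> principal_bisection S s \<otimes>\<^bsub>KS\<^esub> principal_bisection S s'" by fact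
  have "local_bisection (restricted_groupoid S) (principal_bisection S s \<otimes>\<^bsub>KS\<^esub> principal_bisection S s')"
    by (intro RG.bisection_mult principal_bisection_bisection s)
  then have "u \<in> carrier S \<and> \<not> is_zero S u" using m by (auto simp: bisection_iff)
  moreover have "u \<preceq> s \<otimes> s'" using t s by (auto simp: principal_bisection_def intro: nle_mult)
  ultimately show "u \<in> principal_bisection S (s \<otimes> s')" by (simp add: principal_bisection_def)
qed

lemma principal_bisection_hom: "principal_bisection S \<in> zero_hom S KS"
  by (auto simp: zero_hom_def hom_def RG.is_zero_K_iff principal_bisection_bisection
      principal_bisection_mult principal_bisection_zero)

end

section \<open>Layers and parts of a homomorphism to a Boolean inverse semigroup\<close>

text \<open>If \<open>S\<close> has no zero, then the condition on zeros is void and \<open>\<alpha>\<close> is any homomorphism. So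
  the locale also covers the homomorphisms on \<open>S\<close> with a zero adjoined.\<close>

locale finite_representation = S: inverse_semigroup S + T: boolean_inverse_semigroup T
  for S :: "('a, 'm) monoid_scheme" (structure) and T :: "('b, 'n) monoid_scheme" (structure) +
  fixes \<alpha> :: "'a \<Rightarrow> 'b"
  assumes fin: "finite (carrier S)" and \<alpha>: "\<alpha> \<in> zero_hom S T"
begin

abbreviation zeroT :: 'b ("\<zero>") where "\<zero> \<equiv> szero T"

lemma hom: "\<alpha> \<in> hom S T"
  using \<alpha> by (simp add: zero_hom_def)

lemma \<alpha>_closed [simp]: "a \<in> carrier S \<Longrightarrow> \<alpha> a \<in> carrier T"
  using hom_in_carrier[OF hom] .

lemmas \<alpha>_mult = hom_mult[OF hom]
  and \<alpha>_idem [simp] = hom_idem[OF S.inverse_semigroup_axioms T.inverse_semigroup_axioms hom]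
  and \<alpha>_sinv = hom_sinv[OF S.inverse_semigroup_axioms T.inverse_semigroup_axioms hom]
  and \<alpha>_nle = hom_nle[OF S.inverse_semigroup_axioms T.inverse_semigroup_axioms hom]

lemma \<alpha>_zero: "is_zero S z \<Longrightarrow> \<alpha> z = \<zero>"
  using \<alpha> T.szero_eq by (auto simp: zero_hom_def)

lemma finite_idem: "finite (idempotents S)"
  using fin by (rule rev_finite_subset) (rule subsetI, rule S.idem_closed)

definition below :: "'a \<Rightarrow> 'a set" where
  "below e = {f \<in> idempotents S. f \<preceq>\<^bsub>S\<^esub> e \<and> f \<noteq> e}"

text \<open>What remains of \<open>\<alpha> e\<close> once all \<open>\<alpha> f\<close> with \<open>f\<close> strictly below \<open>e\<close> are taken away. The
  value is forced: if \<open>e\<close> is nonzero, it is the image of \<open>{e}\<close> under every morphism that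
  extends \<open>\<alpha>\<close>.\<close>

definition is_layer :: "'a \<Rightarrow> 'b \<Rightarrow> bool" where
  "is_layer e x \<longleftrightarrow> x \<in> idempotents T \<and> lub T (insert x (\<alpha> ` below e)) (\<alpha> e)
    \<and> (\<forall>f\<in>below e. x \<otimes>\<^bsub>T\<^esub> \<alpha> f = \<zero>)"

definition layer :: "'a \<Rightarrow> 'b" where
  "layer e = (SOME x. is_layer e x)"

lemma below_idem: "below e \<subseteq> idempotents S"
  by (auto simp: below_def)

lemma \<alpha>_below: "\<alpha> ` below e \<subseteq> idempotents T"
  by (auto simp: below_def)

lemma layer_exists:
  assumes e: "e \<in> idempotents S"
  shows "is_layer e (layer e)"
proof -
  have "\<exists>x\<in>idempotents T. lub T (insert x (\<alpha> ` below e)) (\<alpha> e)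
    \<and> (\<forall>f\<in>\<alpha> ` below e. x \<otimes>\<^bsub>T\<^esub> f = \<zero>)"
  proof (rule T.relative_complement)
    show "finite (\<alpha> ` below e)" using finite_subset[OF below_idem finite_idem] by blast
    show "\<alpha> ` below e \<subseteq> idempotents T" "\<alpha> e \<in> idempotents T" using \<alpha>_below e by auto
    show "f \<preceq>\<^bsub>T\<^esub> \<alpha> e" if "f \<in> \<alpha> ` below e" for f
      using that e by (auto simp: below_def intro: \<alpha>_nle)
  qed
  then have "\<exists>x. is_layer e x" by (auto simp: is_layer_def)
  then show ?thesis unfolding layer_def by (rule someI_ex)
qed

lemma
  assumes e: "e \<in> idempotents S"
  shows layer_idem [simp]: "layer e \<in> idempotents T"
    and layer_mult_below: "f \<in> below e \<Longrightarrow> layer e \<otimes>\<^bsub>T\<^esub> \<alpha> f = \<zero>"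
    and lub_layer: "lub T (insert (layer e) (\<alpha> ` below e)) (\<alpha> e)"
    and layer_\<alpha> [simp]: "layer e \<otimes>\<^bsub>T\<^esub> \<alpha> e = layer e"
proof -
  show *: "layer e \<in> idempotents T" "lub T (insert (layer e) (\<alpha> ` below e)) (\<alpha> e)"
    using layer_exists[OF e] by (auto simp: is_layer_def)
  show "f \<in> below e \<Longrightarrow> layer e \<otimes>\<^bsub>T\<^esub> \<alpha> f = \<zero>"
    using layer_exists[OF e] by (auto simp: is_layer_def)
  show "layer e \<otimes>\<^bsub>T\<^esub> \<alpha> e = layer e"
    using T.lub_upper[OF *(2), of "layer e"] *(1) e by (simp add: T.idem_nle_iff)
qed

lemma \<alpha>_layer [simp]: "e \<in> idempotents S \<Longrightarrow> \<alpha> e \<otimes>\<^bsub>T\<^esub> layer e = layer e"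
  using T.idem_commute[of "\<alpha> e" "layer e"] by simp

lemma layer_carrier [simp]: "e \<in> idempotents S \<Longrightarrow> layer e \<in> carrier T"
  by (rule T.idem_closed) simp

text \<open>The layer of \<open>e\<close> is the greatest idempotent below \<open>\<alpha> e\<close> that is disjoint from all
  \<open>\<alpha> f\<close> with \<open>f\<close> strictly below \<open>e\<close>: multiply the join \<open>\<alpha> e\<close> by such an idempotent.\<close>

lemma layer_greatest:
  assumes e: "e \<in> idempotents S" and x: "is_layer e x" and y: "y \<in> idempotents T"
    and ye: "y \<otimes>\<^bsub>T\<^esub> \<alpha> e = y" and yf: "\<And>f. f \<in> below e \<Longrightarrow> y \<otimes>\<^bsub>T\<^esub> \<alpha> f = \<zero>"
  shows "y \<preceq>\<^bsub>T\<^esub> x"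
proof -
  let ?X = "insert x (\<alpha> ` below e)"
  have X: "?X \<subseteq> idempotents T" using \<alpha>_below x by (simp add: is_layer_def)
  have xi: "x \<in> idempotents T" using X by simp
  have "lub T ((\<lambda>x. y \<otimes>\<^bsub>T\<^esub> x) ` ?X) (y \<otimes>\<^bsub>T\<^esub> \<alpha> e)"
  proof (rule T.lub_mult)
    show "finite ?X" using finite_subset[OF below_idem finite_idem] by blast
    show "?X \<subseteq> carrier T" using X by auto
    show "pairwise (compatible T) ?X" using T.pairwise_compatible_idem X by blast
  qed (use x y in \<open>auto simp: is_layer_def\<close>)
  then have l: "lub T (insert (y \<otimes>\<^bsub>T\<^esub> x) ((\<lambda>f. y \<otimes>\<^bsub>T\<^esub> \<alpha> f) ` below e)) y"
    using ye by (simp add: image_image)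
  have "y \<preceq>\<^bsub>T\<^esub> x"
  proof (rule T.lub_least[OF l])
    fix z assume "z \<in> insert (y \<otimes>\<^bsub>T\<^esub> x) ((\<lambda>f. y \<otimes>\<^bsub>T\<^esub> \<alpha> f) ` below e)"
    then have "z = y \<otimes>\<^bsub>T\<^esub> x \<or> z = \<zero>" using yf by auto
    then show "z \<preceq>\<^bsub>T\<^esub> x" using xi y by (auto intro: T.idem_mult_nle)
  qed (use xi in simp)
  then show ?thesis .
qed

lemma layer_unique:
  assumes e: "e \<in> idempotents S" and x: "is_layer e x"
  shows "x = layer e"
proof (rule T.nle_antisym)
  have xi: "x \<in> idempotents T" using x by (simp add: is_layer_def)
  then have "x \<otimes>\<^bsub>T\<^esub> \<alpha> e = x"
    using x e T.lub_upper[of _ "\<alpha> e" x] by (auto simp: is_layer_def simp flip: T.idem_nle_iff)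
  then show "x \<preceq>\<^bsub>T\<^esub> layer e"
    using x xi by (intro layer_greatest[OF e layer_exists[OF e]]) (auto simp: is_layer_def)
  show "layer e \<preceq>\<^bsub>T\<^esub> x"
    using e by (intro layer_greatest[OF e x]) (auto simp: layer_mult_below)
  show "x \<in> carrier T" "layer e \<in> carrier T" using xi e by auto
qed

text \<open>The product of the layers of \<open>e\<close> and \<open>f\<close> lies below \<open>\<alpha> (e \<otimes> f)\<close>, and \<open>e \<otimes> f\<close> is strictly
  below \<open>e\<close> or strictly below \<open>f\<close>; the layer of that one is disjoint from it.\<close>

lemma layers_disjoint:
  assumes e: "e \<in> idempotents S" and f: "f \<in> idempotents S" and ne: "e \<noteq> f"
  shows "layer e \<otimes>\<^bsub>T\<^esub> layer f = \<zero>"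
proof -
  have *: "layer e \<otimes>\<^bsub>T\<^esub> layer f = layer e \<otimes>\<^bsub>T\<^esub> \<alpha> (e \<otimes>\<^bsub>S\<^esub> f) \<otimes>\<^bsub>T\<^esub> layer f"
  proof -
    have "layer e \<otimes>\<^bsub>T\<^esub> \<alpha> (e \<otimes>\<^bsub>S\<^esub> f) \<otimes>\<^bsub>T\<^esub> layer f
        = (layer e \<otimes>\<^bsub>T\<^esub> \<alpha> e) \<otimes>\<^bsub>T\<^esub> (\<alpha> f \<otimes>\<^bsub>T\<^esub> layer f)"
      using e f by (simp add: \<alpha>_mult del: layer_\<alpha> \<alpha>_layer)
    then show ?thesis using e f by simp
  qed
  show ?thesis
  proof (cases "e \<otimes>\<^bsub>S\<^esub> f = e")
    case False
    then have "e \<otimes>\<^bsub>S\<^esub> f \<in> below e"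
      using e f S.mult_idem_nle[of e f] by (simp add: below_def)
    then show ?thesis using * e f layer_mult_below by simp
  next
    case True
    then have "e \<in> below f" using e f ne by (simp add: below_def S.idem_nle_iff)
    then have "layer f \<otimes>\<^bsub>T\<^esub> \<alpha> e = \<zero>" using f layer_mult_below by simp
    then have f0: "\<alpha> e \<otimes>\<^bsub>T\<^esub> layer f = \<zero>" using e f T.idem_commute[of "\<alpha> e" "layer f"] by simp
    have "layer e \<otimes>\<^bsub>T\<^esub> layer f = layer e \<otimes>\<^bsub>T\<^esub> \<alpha> e \<otimes>\<^bsub>T\<^esub> layer f"
      using * unfolding True .
    also have "\<dots> = layer e \<otimes>\<^bsub>T\<^esub> (\<alpha> e \<otimes>\<^bsub>T\<^esub> layer f)" using e f by (intro T.m_assoc) auto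
    also have "\<dots> = \<zero>" unfolding f0 using e by simp
    finally show ?thesis .
  qed
qed

text \<open>An idempotent \<open>f\<close> strictly below the range of \<open>b\<close> is conjugate, under \<open>b\<close>, to one strictly
  below the domain of \<open>b\<close>, which is disjoint from the layer of the domain.\<close>

lemma layer_conj_nle:
  assumes b: "b \<in> carrier S"
  shows "\<alpha> b \<otimes>\<^bsub>T\<^esub> layer (sdom S b) \<otimes>\<^bsub>T\<^esub> \<alpha> (sinv S b) \<preceq>\<^bsub>T\<^esub> layer (sran S b)"
    (is "?c \<preceq>\<^bsub>T\<^esub> _")
proof (rule layer_greatest[OF _ layer_exists])
  show "sran S b \<in> idempotents S" "sran S b \<in> idempotents S" using b by auto
  show "?c \<in> idempotents T"
    using b T.conj_idem[of "\<alpha> b" "layer (sdom S b)"] by (simp add: \<alpha>_sinv)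
  have c: "layer (sdom S b) \<in> carrier T" using b by simp
  have "\<alpha> (sinv S b) \<otimes>\<^bsub>T\<^esub> \<alpha> (sran S b) = \<alpha> (sinv S b)"
    using b by (simp add: sran_def flip: \<alpha>_mult)
  then show "?c \<otimes>\<^bsub>T\<^esub> \<alpha> (sran S b) = ?c"
    using b c by simp
  fix f assume f: "f \<in> below (sran S b)"
  then have fi: "f \<in> idempotents S" and fr: "f \<preceq>\<^bsub>S\<^esub> sran S b" "f \<noteq> sran S b"
    by (auto simp: below_def)
  have fb: "f \<otimes>\<^bsub>S\<^esub> sran S b = f" "sran S b \<otimes>\<^bsub>S\<^esub> f = f"
    using fr(1) b fi S.idem_nle_iff[of f "sran S b"] S.idem_commute[of f "sran S b"] by auto
  let ?g = "sinv S b \<otimes>\<^bsub>S\<^esub> f \<otimes>\<^bsub>S\<^esub> b"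
  have gi: "?g \<in> idempotents S" using S.conj_idem'[OF b fi] .
  have "?g \<otimes>\<^bsub>S\<^esub> sdom S b = ?g" using b fi by (simp add: sdom_def)
  then have "?g \<preceq>\<^bsub>S\<^esub> sdom S b" using gi b by (simp add: S.idem_nle_iff)
  moreover have "?g \<noteq> sdom S b"
  proof
    (* Conjugating back with b recovers f, which would be the whole range of b. *)
    assume g: "?g = sdom S b"
    have "f = sran S b \<otimes>\<^bsub>S\<^esub> f \<otimes>\<^bsub>S\<^esub> sran S b" using fb by simp
    also have "\<dots> = b \<otimes>\<^bsub>S\<^esub> ?g \<otimes>\<^bsub>S\<^esub> sinv S b" using b fi by (simp add: sran_def)
    also have "\<dots> = sran S b" unfolding g using b by (simp add: sran_def)
    finally show False using fr by simp
  qed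
  ultimately have "?g \<in> below (sdom S b)" using gi by (simp add: below_def)
  then have g0: "layer (sdom S b) \<otimes>\<^bsub>T\<^esub> \<alpha> ?g = \<zero>" using b layer_mult_below by simp
  have gc: "?g \<in> carrier S" using b fi by simp
  have "sinv S b \<otimes>\<^bsub>S\<^esub> f = ?g \<otimes>\<^bsub>S\<^esub> sinv S b"
  proof -
    have "sinv S b \<otimes>\<^bsub>S\<^esub> f = sinv S b \<otimes>\<^bsub>S\<^esub> (f \<otimes>\<^bsub>S\<^esub> sran S b)" by (simp only: fb)
    then show ?thesis using b fi by (simp add: sran_def)
  qed
  then have "\<alpha> (sinv S b) \<otimes>\<^bsub>T\<^esub> \<alpha> f = \<alpha> ?g \<otimes>\<^bsub>T\<^esub> \<alpha> (sinv S b)"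
    using b fi gc \<alpha>_mult[of "sinv S b" f] \<alpha>_mult[of ?g "sinv S b"] by simp
  then have "?c \<otimes>\<^bsub>T\<^esub> \<alpha> f = \<alpha> b \<otimes>\<^bsub>T\<^esub> (layer (sdom S b) \<otimes>\<^bsub>T\<^esub> \<alpha> ?g) \<otimes>\<^bsub>T\<^esub> \<alpha> (sinv S b)"
    using b c fi gc by simp
  also have "\<dots> = \<zero>" unfolding g0 using b by simp
  finally show "?c \<otimes>\<^bsub>T\<^esub> \<alpha> f = \<zero>" .
qed

text \<open>Conjugation by \<open>b\<close> and by its inverse are mutually inverse order isomorphisms between the
  idempotents below the domain and below the range of \<open>b\<close>, so that they exchange the layers.\<close>

lemma layer_conj:
  assumes b: "b \<in> carrier S"
  shows "\<alpha> b \<otimes>\<^bsub>T\<^esub> layer (sdom S b) \<otimes>\<^bsub>T\<^esub> \<alpha> (sinv S b) = layer (sran S b)"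
proof (rule T.nle_antisym)
  let ?b = "\<alpha> b" and ?b' = "\<alpha> (sinv S b)" and ?r = "layer (sran S b)"
  have c: "?b \<in> carrier T" "?b' \<in> carrier T" "?r \<in> carrier T" "layer (sdom S b) \<in> carrier T"
    using b by auto
  show "?b \<otimes>\<^bsub>T\<^esub> layer (sdom S b) \<otimes>\<^bsub>T\<^esub> ?b' \<preceq>\<^bsub>T\<^esub> ?r" by (rule layer_conj_nle[OF b])
  have r: "?b \<otimes>\<^bsub>T\<^esub> ?b' = \<alpha> (sran S b)"
    using b \<alpha>_mult[of b "sinv S b"] by (simp add: sran_def)
  have "?r = \<alpha> (sran S b) \<otimes>\<^bsub>T\<^esub> (?r \<otimes>\<^bsub>T\<^esub> \<alpha> (sran S b))" using b by simp
  also have "\<dots> = ?b \<otimes>\<^bsub>T\<^esub> (?b' \<otimes>\<^bsub>T\<^esub> ?r \<otimes>\<^bsub>T\<^esub> ?b) \<otimes>\<^bsub>T\<^esub> ?b'"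
    unfolding r[symmetric] using c by simp
  finally have *: "?r = ?b \<otimes>\<^bsub>T\<^esub> (?b' \<otimes>\<^bsub>T\<^esub> ?r \<otimes>\<^bsub>T\<^esub> ?b) \<otimes>\<^bsub>T\<^esub> ?b'" .
  have "?b' \<otimes>\<^bsub>T\<^esub> ?r \<otimes>\<^bsub>T\<^esub> ?b \<preceq>\<^bsub>T\<^esub> layer (sdom S b)"
    using layer_conj_nle[of "sinv S b"] b by simp
  then have "?b \<otimes>\<^bsub>T\<^esub> (?b' \<otimes>\<^bsub>T\<^esub> ?r \<otimes>\<^bsub>T\<^esub> ?b) \<otimes>\<^bsub>T\<^esub> ?b' \<preceq>\<^bsub>T\<^esub> ?b \<otimes>\<^bsub>T\<^esub> layer (sdom S b) \<otimes>\<^bsub>T\<^esub> ?b'"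
    using c by (intro T.nle_mult T.nle_refl) auto
  then show "?r \<preceq>\<^bsub>T\<^esub> ?b \<otimes>\<^bsub>T\<^esub> layer (sdom S b) \<otimes>\<^bsub>T\<^esub> ?b'" using * by argo
  show "?b \<otimes>\<^bsub>T\<^esub> layer (sdom S b) \<otimes>\<^bsub>T\<^esub> ?b' \<in> carrier T" "?r \<in> carrier T" using c by auto
qed

text \<open>The image that \<open>{a}\<close> must have under a morphism that extends \<open>\<alpha>\<close>, if \<open>a\<close> is nonzero.\<close>

definition part :: "'a \<Rightarrow> 'b" where
  "part a = \<alpha> a \<otimes>\<^bsub>T\<^esub> layer (sdom S a)"

lemma part_closed [simp]: "a \<in> carrier S \<Longrightarrow> part a \<in> carrier T"
  by (simp add: part_def)

lemma part_left:
  assumes "a \<in> carrier S"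
  shows "part a = layer (sran S a) \<otimes>\<^bsub>T\<^esub> \<alpha> a"
proof -
  have d: "\<alpha> (sinv S a) \<otimes>\<^bsub>T\<^esub> \<alpha> a = \<alpha> (sdom S a)"
    using assms \<alpha>_mult[of "sinv S a" a] by (simp add: sdom_def)
  have "layer (sran S a) \<otimes>\<^bsub>T\<^esub> \<alpha> a = \<alpha> a \<otimes>\<^bsub>T\<^esub> (layer (sdom S a) \<otimes>\<^bsub>T\<^esub> (\<alpha> (sinv S a) \<otimes>\<^bsub>T\<^esub> \<alpha> a))"
    using assms by (simp flip: layer_conj)
  then show ?thesis using assms by (simp add: d part_def)
qed

text \<open>In other words, \<open>part\<close> represents the restricted groupoid, with composites that are not
  defined going to zero.\<close>

lemma part_mult:
  assumes "a \<in> carrier S" "b \<in> carrier S"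
  shows "part a \<otimes>\<^bsub>T\<^esub> part b = (if sdom S a = sran S b then part (a \<otimes>\<^bsub>S\<^esub> b) else \<zero>)"
proof -
  have ab: "part a \<otimes>\<^bsub>T\<^esub> part b
      = \<alpha> a \<otimes>\<^bsub>T\<^esub> (layer (sdom S a) \<otimes>\<^bsub>T\<^esub> layer (sran S b)) \<otimes>\<^bsub>T\<^esub> \<alpha> b"
    using assms by (simp add: part_def[of a] part_left[of b])
  show ?thesis
  proof (cases "sdom S a = sran S b")
    case True
    then have "part a \<otimes>\<^bsub>T\<^esub> part b = \<alpha> a \<otimes>\<^bsub>T\<^esub> part b"
      using assms by (simp add: ab) (simp add: part_left)
    also have "\<dots> = part (a \<otimes>\<^bsub>S\<^esub> b)"
      using assms True by (simp add: part_def \<alpha>_mult S.sdom_mult_of_composable)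
    finally show ?thesis using True by simp
  next
    case False
    then show ?thesis using assms layers_disjoint[of "sdom S a" "sran S b"] by (simp add: ab)
  qed
qed

lemma part_sinv:
  assumes "a \<in> carrier S"
  shows "sinv T (part a) = part (sinv S a)"
  using assms by (simp add: part_def[of a] T.sinv_mult \<alpha>_sinv part_left[of "sinv S a"])

lemma part_zero: "is_zero S z \<Longrightarrow> part z = \<zero>"
  by (simp add: part_def \<alpha>_zero)

lemma part_compatible:
  assumes "A \<subseteq> carrier S" "inj_on (sdom S) A" "inj_on (sran S) A"
  shows "pairwise (compatible T) (part ` A)"
proof (rule pairwiseI)
  fix x y assume "x \<in> part ` A" "y \<in> part ` A" "x \<noteq> y"
  then obtain a b where ab: "x = part a" "y = part b" "a \<in> A" "b \<in> A" "a \<noteq> b" by auto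
  then have "a \<in> carrier S" "b \<in> carrier S" "sdom S a \<noteq> sdom S b" "sran S a \<noteq> sran S b"
    using assms by (auto dest: inj_onD)
  then show "compatible T x y" by (simp add: ab compatible_def part_sinv part_mult)
qed

text \<open>Every \<open>\<alpha> e\<close> is the join of the layers below it, by induction: the defining property of
  the top layer reduces this to the idempotents strictly below \<open>e\<close>.\<close>

lemma lub_layers:
  assumes "e \<in> idempotents S"
  shows "lub T (layer ` {f \<in> idempotents S. f \<preceq>\<^bsub>S\<^esub> e}) (\<alpha> e)"
  using assms
proof (induction "card (below e)" arbitrary: e rule: less_induct)
  case less
  note e = less.prems
  let ?D = "\<lambda>e. {f \<in> idempotents S. f \<preceq>\<^bsub>S\<^esub> e}"
  have IH: "lub T (layer ` ?D f) (\<alpha> f)" if f: "f \<in> below e" for f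
  proof (rule less.hyps)
    have fi: "f \<in> idempotents S" "f \<preceq>\<^bsub>S\<^esub> e" "f \<noteq> e" using f by (auto simp: below_def)
    have "below f \<subset> below e"
    proof
      show "below f \<subseteq> below e"
      proof
        fix g assume "g \<in> below f"
        then have g: "g \<in> idempotents S" "g \<preceq>\<^bsub>S\<^esub> f" "g \<noteq> f" by (auto simp: below_def)
        have "g \<preceq>\<^bsub>S\<^esub> e" using S.nle_trans[of g f e] g fi e by simp
        moreover have "g \<noteq> e" using S.nle_antisym[of f e] g fi e by auto
        ultimately show "g \<in> below e" using g by (simp add: below_def)
      qed
      show "below f \<noteq> below e" using f by (auto simp: below_def)
    qed
    then show "card (below f) < card (below e)"
      using finite_subset[OF below_idem finite_idem] by (intro psubset_card_mono) auto
    show "f \<in> idempotents S" by (rule fi)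
  qed
  have layer_le: "layer f \<preceq>\<^bsub>T\<^esub> \<alpha> f" if "f \<in> idempotents S" for f
    using that by (simp add: T.idem_nle_iff)
  show ?case
  proof (rule T.lubI)
    fix x assume "x \<in> layer ` ?D e"
    then obtain f where f: "x = layer f" "f \<in> idempotents S" "f \<preceq>\<^bsub>S\<^esub> e" by auto
    then show "x \<preceq>\<^bsub>T\<^esub> \<alpha> e"
      using layer_le[of f] \<alpha>_nle[of f e] e T.nle_trans[of "layer f" "\<alpha> f" "\<alpha> e"] by simp
  next
    fix u assume u: "u \<in> carrier T" "\<And>x. x \<in> layer ` ?D e \<Longrightarrow> x \<preceq>\<^bsub>T\<^esub> u"
    show "\<alpha> e \<preceq>\<^bsub>T\<^esub> u"
    proof (rule T.lub_least[OF lub_layer[OF e] u(1)])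
      fix x assume "x \<in> insert (layer e) (\<alpha> ` below e)"
      then consider "x = layer e" | f where "f \<in> below e" "x = \<alpha> f" by auto
      then show "x \<preceq>\<^bsub>T\<^esub> u"
      proof cases
        case 1
        then show ?thesis using u(2) e by simp
      next
        case 2
        have "\<alpha> f \<preceq>\<^bsub>T\<^esub> u"
        proof (rule T.lub_least[OF IH[OF 2(1)] u(1)])
          fix y assume "y \<in> layer ` ?D f"
          then obtain g where g: "y = layer g" "g \<in> idempotents S" "g \<preceq>\<^bsub>S\<^esub> f" by auto
          have "g \<preceq>\<^bsub>S\<^esub> e" using S.nle_trans[of g f e] g 2(1) e by (simp add: below_def)
          then show "y \<preceq>\<^bsub>T\<^esub> u" using u(2) g by simp
        qed
        then show ?thesis using 2 by simp
      qed
    qed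
  qed (use e in simp)
qed

text \<open>Multiply the decomposition of \<open>\<alpha> (sdom S s)\<close> into layers by \<open>\<alpha> s\<close>: the idempotents \<open>f\<close>
  below the domain of \<open>s\<close> correspond to the elements \<open>s \<otimes> f\<close> below \<open>s\<close>.\<close>

lemma lub_parts:
  assumes s: "s \<in> carrier S"
  shows "lub T (part ` principal_bisection S s) (\<alpha> s)"
proof -
  let ?D = "{f \<in> idempotents S. f \<preceq>\<^bsub>S\<^esub> sdom S s}"
  have di: "sdom S s \<in> idempotents S" using s by simp
  have "lub T ((\<lambda>x. \<alpha> s \<otimes>\<^bsub>T\<^esub> x) ` layer ` ?D) (\<alpha> s \<otimes>\<^bsub>T\<^esub> \<alpha> (sdom S s))"
  proof (rule T.lub_mult[OF lub_layers[OF di]])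
    show "finite (layer ` ?D)" using finite_idem by simp
    have i: "layer ` ?D \<subseteq> idempotents T" by auto
    show "pairwise (compatible T) (layer ` ?D)" by (rule T.pairwise_compatible_idem[OF i])
    show "layer ` ?D \<subseteq> carrier T" by auto
  qed (use s in simp)
  moreover have "\<alpha> s \<otimes>\<^bsub>T\<^esub> \<alpha> (sdom S s) = \<alpha> s" using s by (simp flip: \<alpha>_mult)
  moreover have "(\<lambda>x. \<alpha> s \<otimes>\<^bsub>T\<^esub> x) ` layer ` ?D = part ` {t \<in> carrier S. t \<preceq>\<^bsub>S\<^esub> s}"
  proof -
    have p: "\<alpha> s \<otimes>\<^bsub>T\<^esub> layer f = part (s \<otimes>\<^bsub>S\<^esub> f)" if f: "f \<in> ?D" for f
    proof -
      have "sdom S s \<otimes>\<^bsub>S\<^esub> f = f"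
        using f s di S.idem_nle_iff[of f "sdom S s"] S.idem_commute[of f "sdom S s"] by simp
      moreover have "sdom S (s \<otimes>\<^bsub>S\<^esub> f) = f \<otimes>\<^bsub>S\<^esub> (sdom S s \<otimes>\<^bsub>S\<^esub> f)"
        using f s by (simp add: sdom_def S.sinv_mult)
      ultimately have "sdom S (s \<otimes>\<^bsub>S\<^esub> f) = f" using f by simp
      then show ?thesis using f s by (simp add: part_def \<alpha>_mult)
    qed
    have "{t \<in> carrier S. t \<preceq>\<^bsub>S\<^esub> s} = (\<lambda>f. s \<otimes>\<^bsub>S\<^esub> f) ` ?D"
    proof (intro equalityI subsetI)
      fix t assume t: "t \<in> {t \<in> carrier S. t \<preceq>\<^bsub>S\<^esub> s}"
      then have "t = s \<otimes>\<^bsub>S\<^esub> sdom S t" "sdom S t \<in> ?D"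
        using s S.nle_iff_sdom[of t s] S.nle_sdom[of t s] by auto
      then show "t \<in> (\<lambda>f. s \<otimes>\<^bsub>S\<^esub> f) ` ?D" by blast
    next
      fix t assume "t \<in> (\<lambda>f. s \<otimes>\<^bsub>S\<^esub> f) ` ?D"
      then show "t \<in> {t \<in> carrier S. t \<preceq>\<^bsub>S\<^esub> s}" using s S.mult_idem_nle by auto
    qed
    then show ?thesis using p by (simp add: image_image)
  qed
  ultimately have *: "lub T (part ` {t \<in> carrier S. t \<preceq>\<^bsub>S\<^esub> s}) (\<alpha> s)" by simp
  (* The zero of S, if there is one, is not in the bisection; its part is zero. *)
  have "insert \<zero> (part ` {t \<in> carrier S. t \<preceq>\<^bsub>S\<^esub> s}) = insert \<zero> (part ` principal_bisection S s)"
    using part_zero by (auto simp: principal_bisection_def)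
  then show ?thesis using * T.lub_cong_zero[OF T.is_zero_szero] by blast
qed

section \<open>The extension to local bisections\<close>

definition extension :: "'a set \<Rightarrow> 'b" where
  "extension A = (THE j. lub T (part ` A) j)"

lemma extension_eqI:
  assumes "lub T (part ` A) j"
  shows "extension A = j"
  unfolding extension_def using assms
proof (rule the_equality)
  show "i = j" if "lub T (part ` A) i" for i using that assms by (rule T.lub_unique)
qed

lemma lub_extension:
  assumes "local_bisection (restricted_groupoid S) A"
  shows "lub T (part ` A) (extension A)"
proof -
  have A: "A \<subseteq> carrier S" "inj_on (sdom S) A" "inj_on (sran S) A"
    using assms by (auto simp: S.bisection_iff)
  then obtain j where j: "lub T (part ` A) j"
    using T.finite_compatible_join[OF _ _ part_compatible[OF A]] finite_subset[OF A(1) fin] by fastforce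
  then show ?thesis using extension_eqI[OF j] by simp
qed

lemma extension_principal: "s \<in> carrier S \<Longrightarrow> extension (principal_bisection S s) = \<alpha> s"
  by (rule extension_eqI) (rule lub_parts)

text \<open>A product of two joins is the join of the products. By \<open>part_mult\<close> those are the parts of the
  composites, apart from zeros, which do not affect a join.\<close>

lemma extension_mult:
  assumes A: "local_bisection (restricted_groupoid S) A" and B: "local_bisection (restricted_groupoid S) B"
  shows "extension (A \<otimes>\<^bsub>S.KS\<^esub> B) = extension A \<otimes>\<^bsub>T\<^esub> extension B"
proof (rule extension_eqI)
  have cA: "A \<subseteq> carrier S" "inj_on (sdom S) A" "inj_on (sran S) A"
    and cB: "B \<subseteq> carrier S" "inj_on (sdom S) B" "inj_on (sran S) B"
    using A B by (auto simp: S.bisection_iff)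
  let ?X = "{x \<otimes>\<^bsub>T\<^esub> y | x y. x \<in> part ` A \<and> y \<in> part ` B}"
  have "lub T ?X (extension A \<otimes>\<^bsub>T\<^esub> extension B)"
    using finite_subset[OF cA(1) fin] finite_subset[OF cB(1) fin] cA(1) cB(1)
    by (intro T.lub_mult_lub lub_extension A B part_compatible cA cB) auto
  moreover have "insert \<zero> ?X = insert \<zero> (part ` (A \<otimes>\<^bsub>S.KS\<^esub> B))"
  proof -
    have p: "part a \<otimes>\<^bsub>T\<^esub> part b = (if sdom S a = sran S b then part (a \<otimes>\<^bsub>S\<^esub> b) else \<zero>)"
      if "a \<in> A" "b \<in> B" for a b
      using part_mult[OF subsetD[OF cA(1) that(1)] subsetD[OF cB(1) that(2)]] .
    show ?thesis
    proof (intro equalityI subsetI)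
      fix z assume "z \<in> insert \<zero> ?X"
      then consider "z = \<zero>" | a b where "a \<in> A" "b \<in> B" "z = part a \<otimes>\<^bsub>T\<^esub> part b" by auto
      then show "z \<in> insert \<zero> (part ` (A \<otimes>\<^bsub>S.KS\<^esub> B))"
        by cases (auto simp: p S.KS_mult[OF cA(1) cB(1)])
    next
      fix z assume "z \<in> insert \<zero> (part ` (A \<otimes>\<^bsub>S.KS\<^esub> B))"
      then consider "z = \<zero>" | a b where "a \<in> A" "b \<in> B" "sdom S a = sran S b" "z = part (a \<otimes>\<^bsub>S\<^esub> b)"
        by (auto simp: S.KS_mult[OF cA(1) cB(1)])
      then show "z \<in> insert \<zero> ?X"
      proof cases
        case 2
        then have "z = part a \<otimes>\<^bsub>T\<^esub> part b" by (simp add: p)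
        then show ?thesis using 2 by blast
      qed simp
    qed
  qed
  ultimately show "lub T (part ` (A \<otimes>\<^bsub>S.KS\<^esub> B)) (extension A \<otimes>\<^bsub>T\<^esub> extension B)"
    using T.lub_cong_zero[OF T.is_zero_szero] by blast
qed

lemma extension_boolean_morphism: "extension \<in> boolean_morphism S.KS T"
  unfolding boolean_morphism_def zero_hom_def
proof (intro CollectI conjI ballI allI impI)
  show "extension \<in> hom S.KS T"
    using lub_extension T.lub_closed extension_mult by (auto simp: hom_def)
  show "is_zero T (extension Z)" if "is_zero S.KS Z" for Z
    using that extension_eqI[of "{}"] T.lub_empty by (simp add: S.RG.is_zero_K_iff)
  fix A B J assume "A \<in> carrier S.KS" "B \<in> carrier S.KS"
    and J: "compatible S.KS A B \<and> is_join S.KS J A B"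
  then have A: "local_bisection (restricted_groupoid S) A"
    and B: "local_bisection (restricted_groupoid S) B" by auto
  have "J = A \<union> B" using S.RG.is_join_K_iff[OF A B] J by blast
  moreover have "local_bisection (restricted_groupoid S) (A \<union> B)"
    using S.RG.compatible_union[OF A B] J by blast
  ultimately have "lub T (part ` A \<union> part ` B) (extension J)"
    using lub_extension[of J] by (simp add: image_Un)
  then have "lub T {extension A, extension B} (extension J)"
    using S.bisection_carrier_S[OF A] S.bisection_carrier_S[OF B]
    by (intro T.lub_pair[OF lub_extension[OF A] lub_extension[OF B]]) auto
  then show "is_join T (extension J) (extension A) (extension B)"
    using lub_extension[OF A] lub_extension[OF B] T.lub_closed by (simp add: is_join_iff_lub)
qed

end

section \<open>Uniqueness of the extension\<close>

text \<open>Local bisections inside one local bisection are compatible, so binary joins suffice.\<close>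

lemma (in groupoid_laws) boolean_morphism_Union:
  assumes T: "boolean_inverse_semigroup T" and h: "h \<in> boolean_morphism (K G) T"
    and "finite \<X>" "local_bisection G (\<Union>\<X>)"
  shows "lub T (h ` \<X>) (h (\<Union>\<X>))"
  using assms(3,4)
proof (induction \<X>)
  interpret T: boolean_inverse_semigroup T by (rule T)
  interpret KG: inverse_semigroup "K G" by (rule inverse_semigroup_K)
  have hc: "h A \<in> carrier T" if "local_bisection G A" for A
    using that h by (auto simp: boolean_morphism_def zero_hom_def hom_def)
  {
    case empty
    have "is_zero T (h {})" using h is_zero_K_iff by (auto simp: boolean_morphism_def zero_hom_def)
    then show ?case using T.lub_empty T.szero_eq by auto
  next
    case (insert A \<X>)
    have b: "local_bisection G A" "local_bisection G (\<Union>\<X>)" "local_bisection G (A \<union> \<Union>\<X>)"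
      using insert.prems by (auto intro: bisection_subset)
    have sub: "h ` \<X> \<subseteq> carrier T"
      using hc bisection_subset[OF b(2)] by blast
    have "compatible (K G) A (\<Union>\<X>)"
      using b by (intro KG.compatible_of_nle[of A "A \<union> \<Union>\<X>"]) (auto simp: nle_K)
    then have "is_join T (h (A \<union> \<Union>\<X>)) (h A) (h (\<Union>\<X>))"
      using h b is_join_K_iff[OF b(1,2)] by (auto simp: boolean_morphism_def)
    then have "lub T (insert (h A) (h ` \<X>)) (h (A \<union> \<Union>\<X>))"
      using hc b sub by (intro T.lub_insert[OF insert.IH[OF b(2)]]) (auto simp: is_join_iff_lub)
    then show ?case by simp
  }
qed

context finite_representation
begin

lemma idem_singleton:
  assumes e: "e \<in> idempotents S" "\<not> is_zero S e"
  shows "local_bisection (restricted_groupoid S) {e}" "{e} \<in> idempotents S.KS"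
proof -
  show "local_bisection (restricted_groupoid S) {e}" using e by (simp add: S.bisection_iff)
  have "e \<in> gdom (restricted_groupoid S) ` carrier (restricted_groupoid S)"
    using e S.restricted_gdom[of e] S.restricted_carrier[of e] by (intro image_eqI[of _ _ e]) auto
  then show "{e} \<in> idempotents S.KS" by (simp add: S.RG.idempotents_K)
qed

text \<open>A morphism that extends \<open>\<alpha>\<close> has no choice at \<open>{e}\<close>: this is the part of the bisection of
  \<open>e\<close> not covered by those of the idempotents strictly below \<open>e\<close>, so its image is the layer of \<open>e\<close>.\<close>

lemma morphism_idem_singleton:
  assumes h: "h \<in> boolean_morphism S.KS T" and ext: "\<And>s. s \<in> carrier S \<Longrightarrow> h (principal_bisection S s) = \<alpha> s"
    and e: "e \<in> idempotents S" "\<not> is_zero S e"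
  shows "h {e} = layer e"
proof (rule layer_unique[OF e(1)])
  have hh: "h \<in> hom S.KS T" and hz: "h {} = \<zero>"
    using h S.RG.is_zero_K_iff T.szero_eq by (auto simp: boolean_morphism_def zero_hom_def)
  note eb = idem_singleton[OF e]
  have pe: "principal_bisection S f = {g \<in> idempotents S. g \<preceq>\<^bsub>S\<^esub> f \<and> \<not> is_zero S g}"
    if "f \<in> idempotents S" for f
    using that S.nle_idem[of _ f] by (auto simp: principal_bisection_def)
  have "h {e} \<in> idempotents T"
    using eb(2) by (rule hom_idem[OF S.RG.inverse_semigroup_K T.inverse_semigroup_axioms hh])
  moreover have "lub T (insert (h {e}) (\<alpha> ` below e)) (\<alpha> e)"
  proof -
    let ?X = "insert {e} (principal_bisection S ` below e)"
    have "\<Union>?X = principal_bisection S e"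
    proof -
      have tr: "g \<preceq>\<^bsub>S\<^esub> e" if "g \<in> idempotents S" "g \<preceq>\<^bsub>S\<^esub> f" "f \<in> below e" for f g
        using S.nle_trans[of g f e] that e by (simp add: below_def)
      have pb: "principal_bisection S f = {g \<in> idempotents S. g \<preceq>\<^bsub>S\<^esub> f \<and> \<not> is_zero S g}"
        if "f \<in> below e" for f using pe[of f] that by (simp add: below_def)
      show ?thesis
      proof (intro equalityI subsetI)
        fix g assume "g \<in> \<Union>?X"
        then consider "g = e" | f where "f \<in> below e" "g \<in> principal_bisection S f" by auto
        then show "g \<in> principal_bisection S e"
        proof cases
          case 1
          then show ?thesis using e by (simp add: principal_bisection_def)
        next
          case 2
          then have "g \<in> idempotents S" "g \<preceq>\<^bsub>S\<^esub> f" "\<not> is_zero S g" using pb[OF 2(1)] by auto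
          then show ?thesis using tr[of g f] 2(1) pe[OF e(1)] by blast
        qed
      next
        fix g assume g: "g \<in> principal_bisection S e"
        show "g \<in> \<Union>?X"
        proof (cases "g = e")
          case False
          then have "g \<in> below e" "g \<in> principal_bisection S g"
            using g pe[OF e(1)] by (auto simp: below_def principal_bisection_def)
          then show ?thesis by blast
        qed simp
      qed
    qed
    moreover have "finite ?X" using finite_subset[OF below_idem finite_idem] by blast
    ultimately have "lub T (h ` ?X) (h (principal_bisection S e))"
      using S.RG.boolean_morphism_Union[OF T.boolean_inverse_semigroup_axioms h, of ?X]
        S.principal_bisection_bisection[of e] e by simp
    moreover have "h ` principal_bisection S ` below e = \<alpha> ` below e"
      using ext by (auto simp: image_image below_def)
    ultimately show ?thesis using ext e by simp
  qed
  moreover have "h {e} \<otimes>\<^bsub>T\<^esub> \<alpha> f = \<zero>" if f: "f \<in> below e" for f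
  proof -
    have fi: "f \<in> idempotents S" "f \<preceq>\<^bsub>S\<^esub> e" "f \<noteq> e" using f by (auto simp: below_def)
    have "e \<notin> principal_bisection S f"
      using S.nle_antisym[of e f] fi e by (auto simp: principal_bisection_def)
    then have "{e} \<otimes>\<^bsub>S.KS\<^esub> principal_bisection S f = {}"
    proof -
      have "e \<noteq> sran S g" if "g \<in> principal_bisection S f" for g
        using that \<open>e \<notin> _\<close> unfolding pe[OF fi(1)] by auto
      then show ?thesis
        using S.KS_mult[of "{e}" "principal_bisection S f"] e(1) S.principal_bisection_carrier[of f] by simp
    qed
    then have "h {e} \<otimes>\<^bsub>T\<^esub> h (principal_bisection S f) = \<zero>"
      using hom_mult[OF hh, of "{e}" "principal_bisection S f"] hz eb fi S.principal_bisection_bisection by simp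
    then show ?thesis using ext fi by simp
  qed
  ultimately show "is_layer e (h {e})" by (simp add: is_layer_def)
qed

text \<open>Cut \<open>{a}\<close> out of the bisection of \<open>a\<close> by multiplying with the singleton of its domain.\<close>

lemma morphism_singleton:
  assumes h: "h \<in> boolean_morphism S.KS T" and ext: "\<And>s. s \<in> carrier S \<Longrightarrow> h (principal_bisection S s) = \<alpha> s"
    and a: "a \<in> carrier S" "\<not> is_zero S a"
  shows "h {a} = part a"
proof -
  have hh: "h \<in> hom S.KS T" using h by (auto simp: boolean_morphism_def zero_hom_def)
  have d: "sdom S a \<in> idempotents S" "\<not> is_zero S (sdom S a)"
    using a S.is_zero_of_sdom[OF a(1)] by (simp, blast)
  have "principal_bisection S a \<otimes>\<^bsub>S.KS\<^esub> {sdom S a} = {a}"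
  proof -
    have "t \<otimes>\<^bsub>S\<^esub> sdom S a = a" if "t \<in> principal_bisection S a" "sdom S t = sdom S a" for t
      using that a S.nle_iff_sdom[of t a] by (auto simp: principal_bisection_def)
    moreover have "a \<in> principal_bisection S a" using a by (simp add: principal_bisection_def)
    ultimately show ?thesis
      using S.KS_mult[OF S.principal_bisection_carrier, of "{sdom S a}" a] a d by fastforce
  qed
  then have "h {a} = h (principal_bisection S a) \<otimes>\<^bsub>T\<^esub> h {sdom S a}"
    using hom_mult[OF hh, of "principal_bisection S a" "{sdom S a}"] a
      idem_singleton[OF d] S.principal_bisection_bisection by simp
  then show ?thesis
    using ext[OF a(1)] morphism_idem_singleton[OF h ext d] by (simp add: part_def)
qed

lemma morphism_eq_extension:
  assumes h: "h \<in> boolean_morphism S.KS T" and ext: "\<And>s. s \<in> carrier S \<Longrightarrow> h (principal_bisection S s) = \<alpha> s"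
    and A: "local_bisection (restricted_groupoid S) A"
  shows "h A = extension A"
proof -
  have c: "a \<in> carrier S" "\<not> is_zero S a" if "a \<in> A" for a using A that by (auto simp: S.bisection_iff)
  have "finite A" using finite_subset[OF S.bisection_carrier_S[OF A] fin] .
  then have "lub T (h ` (\<lambda>a. {a}) ` A) (h (\<Union>((\<lambda>a. {a}) ` A)))"
    using A by (intro S.RG.boolean_morphism_Union[OF T.boolean_inverse_semigroup_axioms h]) auto
  moreover have "h ` (\<lambda>a. {a}) ` A = part ` A"
    using morphism_singleton[OF h ext c] by (auto simp: image_image)
  ultimately show ?thesis using extension_eqI[of A "h A"] by simp
qed

text \<open>Extensionality makes a morphism unique as a function, so \<open>extension\<close> has to be restricted.\<close>

theorem unique_extension:
  "\<exists>!h. h \<in> extensional (carrier S.KS) \<and> h \<in> boolean_morphism S.KS T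
    \<and> (\<forall>s\<in>carrier S. h (principal_bisection S s) = \<alpha> s)"
proof (rule ex1I[of _ "restrict extension (carrier S.KS)"], intro conjI ballI)
  let ?h = "restrict extension (carrier S.KS)"
  have c: "A \<otimes>\<^bsub>S.KS\<^esub> B \<in> carrier S.KS" if "A \<in> carrier S.KS" "B \<in> carrier S.KS" for A B
    using that S.RG.bisection_mult by simp
  show "?h \<in> boolean_morphism S.KS T"
    unfolding boolean_morphism_def zero_hom_def
  proof (intro CollectI conjI ballI allI impI)
    have e: "extension \<in> hom S.KS T" "\<And>Z. is_zero S.KS Z \<Longrightarrow> is_zero T (extension Z)"
      using extension_boolean_morphism by (auto simp: boolean_morphism_def zero_hom_def)
    show "?h \<in> hom S.KS T" using e(1) c unfolding hom_def by (simp add: restrict_PiE_iff Pi_iff)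
    show "is_zero T (?h Z)" if "is_zero S.KS Z" for Z
      using e(2)[OF that] that by (simp add: S.RG.is_zero_K_iff S.bisection_iff)
    fix A B J assume AB: "A \<in> carrier S.KS" "B \<in> carrier S.KS" "compatible S.KS A B \<and> is_join S.KS J A B"
    then have "J \<in> carrier S.KS" by (simp add: is_join_iff_lub lub_def)
    then show "is_join T (?h J) (?h A) (?h B)"
      using extension_boolean_morphism AB unfolding boolean_morphism_def by simp
  qed
  show "?h (principal_bisection S s) = \<alpha> s" if "s \<in> carrier S" for s
    using that extension_principal S.principal_bisection_bisection by simp
next
  fix h assume h: "h \<in> extensional (carrier S.KS) \<and> h \<in> boolean_morphism S.KS T
    \<and> (\<forall>s\<in>carrier S. h (principal_bisection S s) = \<alpha> s)"
  show "h = restrict extension (carrier S.KS)"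
  proof (rule extensionalityI[of _ "carrier S.KS"])
    show "h A = restrict extension (carrier S.KS) A" if "A \<in> carrier S.KS" for A
      using morphism_eq_extension[of h A] h that by simp
  qed (use h in auto)
qed simp

end

section \<open>The universal property\<close>

lemma boolean_morphism_comp:
  assumes S: "inverse_semigroup S" and T: "inverse_semigroup T" and U: "inverse_semigroup U"
    and f: "f \<in> boolean_morphism S T" and g: "g \<in> boolean_morphism T U"
  shows "restrict (g \<circ> f) (carrier S) \<in> boolean_morphism S U"
proof -
  have hf: "f \<in> hom S T" and hg: "g \<in> hom T U"
    using f g by (auto simp: boolean_morphism_def zero_hom_def)
  have c: "f a \<in> carrier T" if "a \<in> carrier S" for a using hom_in_carrier[OF hf that] .
  have m: "a \<otimes>\<^bsub>S\<^esub> b \<in> carrier S" if "a \<in> carrier S" "b \<in> carrier S" for a b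
    using inverse_semigroup.m_closed[OF S that] .
  have "restrict (g \<circ> f) (carrier S) \<in> hom S U"
    using hom_in_carrier[OF hg] c m hom_mult[OF hf] hom_mult[OF hg] by (intro homI) simp_all
  moreover have "is_zero U (restrict (g \<circ> f) (carrier S) z)" if "is_zero S z" for z
  proof -
    have "z \<in> carrier S" using that by (simp add: is_zero_def)
    then show ?thesis using f g that by (simp add: boolean_morphism_def zero_hom_def)
  qed
  moreover have "is_join U (restrict (g \<circ> f) (carrier S) j) (restrict (g \<circ> f) (carrier S) a)
      (restrict (g \<circ> f) (carrier S) b)"
    if ab: "a \<in> carrier S" "b \<in> carrier S" "compatible S a b" and j: "is_join S j a b" for a b j
  proof -
    have "j \<in> carrier S" using j ab by (simp add: is_join_iff_lub lub_def)
    moreover have "is_join T (f j) (f a) (f b)"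
      using f ab j unfolding boolean_morphism_def by blast
    moreover have "compatible T (f a) (f b)" using hom_compatible[OF S T hf] ab by blast
    ultimately show ?thesis using g ab c unfolding boolean_morphism_def by simp
  qed
  ultimately show ?thesis unfolding boolean_morphism_def zero_hom_def by blast
qed

lemma boolean_morphism_id: "restrict id (carrier S) \<in> boolean_morphism S S"
  if S: "inverse_semigroup S"
proof -
  have "restrict id (carrier S) \<in> hom S S"
    using inverse_semigroup.m_closed[OF S] by (intro homI) simp_all
  moreover have "is_zero S (restrict id (carrier S) z)" if "is_zero S z" for z
  proof -
    have "z \<in> carrier S" using that by (simp add: is_zero_def)
    then show ?thesis using that by simp
  qed
  moreover have "is_join S (restrict id (carrier S) j) (restrict id (carrier S) a) (restrict id (carrier S) b)"
    if ab: "a \<in> carrier S" "b \<in> carrier S" and j: "is_join S j a b" for a b j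
  proof -
    have "j \<in> carrier S" using j ab by (simp add: is_join_iff_lub lub_def)
    then show ?thesis using ab j by simp
  qed
  ultimately show ?thesis unfolding boolean_morphism_def zero_hom_def by blast
qed

text \<open>Universal objects are unique up to isomorphism, by the usual argument. Either object has to
  be universal for test objects on its own element type and on that of the other.\<close>

lemma booleanization_with_zero_unique:
  fixes B :: "'b monoid" and C :: "'c monoid"
  assumes Bb: "is_booleanization_with_zero TYPE('b) S B \<beta>" and Bc: "is_booleanization_with_zero TYPE('c) S B \<beta>"
    and Cb: "is_booleanization_with_zero TYPE('b) S C \<kappa>" and Cc: "is_booleanization_with_zero TYPE('c) S C \<kappa>"
  shows "B \<cong> C"
proof -
  have B: "boolean_inverse_semigroup B" "\<beta> \<in> zero_hom S B"
    and C: "boolean_inverse_semigroup C" "\<kappa> \<in> zero_hom S C"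
    using Bb Cb by (auto simp: is_booleanization_with_zero_def)
  interpret B: boolean_inverse_semigroup B by (rule B)
  interpret C: boolean_inverse_semigroup C by (rule C)
  obtain f where f: "f \<in> boolean_morphism B C" "\<And>s. s \<in> carrier S \<Longrightarrow> f (\<beta> s) = \<kappa> s"
    using Bc C unfolding is_booleanization_with_zero_def by blast
  obtain g where g: "g \<in> boolean_morphism C B" "\<And>s. s \<in> carrier S \<Longrightarrow> g (\<kappa> s) = \<beta> s"
    using Cb B unfolding is_booleanization_with_zero_def by blast
  have \<beta>c: "\<beta> s \<in> carrier B" and \<kappa>c: "\<kappa> s \<in> carrier C" if "s \<in> carrier S" for s
    using that B(2) C(2) by (auto simp: zero_hom_def hom_def)
  have uB: "\<exists>!\<gamma>. \<gamma> \<in> extensional (carrier B) \<and> \<gamma> \<in> boolean_morphism B B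
      \<and> (\<forall>s\<in>carrier S. \<gamma> (\<beta> s) = \<beta> s)"
    using Bb B unfolding is_booleanization_with_zero_def by blast
  have uC: "\<exists>!\<gamma>. \<gamma> \<in> extensional (carrier C) \<and> \<gamma> \<in> boolean_morphism C C
      \<and> (\<forall>s\<in>carrier S. \<gamma> (\<kappa> s) = \<kappa> s)"
    using Cc C unfolding is_booleanization_with_zero_def by blast
  have gf: "restrict (g \<circ> f) (carrier B) = restrict id (carrier B)"
  proof (rule ex1E[OF uB])
    fix \<gamma> assume u: "\<forall>\<gamma>'. \<gamma>' \<in> extensional (carrier B) \<and> \<gamma>' \<in> boolean_morphism B B
      \<and> (\<forall>s\<in>carrier S. \<gamma>' (\<beta> s) = \<beta> s) \<longrightarrow> \<gamma>' = \<gamma>"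
    have 1: "restrict (g \<circ> f) (carrier B) \<in> boolean_morphism B B"
      by (intro boolean_morphism_comp[of _ C] f g B.inverse_semigroup_axioms C.inverse_semigroup_axioms)
    have 2: "restrict id (carrier B) \<in> boolean_morphism B B"
      by (intro boolean_morphism_id B.inverse_semigroup_axioms)
    have "restrict (g \<circ> f) (carrier B) = \<gamma>"
      by (rule u[rule_format]) (use 1 f(2) g(2) \<beta>c in simp)
    moreover have "restrict id (carrier B) = \<gamma>"
      by (rule u[rule_format]) (use 2 \<beta>c in simp)
    ultimately show ?thesis by simp
  qed
  have fg: "restrict (f \<circ> g) (carrier C) = restrict id (carrier C)"
  proof (rule ex1E[OF uC])
    fix \<gamma> assume u: "\<forall>\<gamma>'. \<gamma>' \<in> extensional (carrier C) \<and> \<gamma>' \<in> boolean_morphism C C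
      \<and> (\<forall>s\<in>carrier S. \<gamma>' (\<kappa> s) = \<kappa> s) \<longrightarrow> \<gamma>' = \<gamma>"
    have 1: "restrict (f \<circ> g) (carrier C) \<in> boolean_morphism C C"
      by (intro boolean_morphism_comp[of _ B] f g B.inverse_semigroup_axioms C.inverse_semigroup_axioms)
    have 2: "restrict id (carrier C) \<in> boolean_morphism C C"
      by (intro boolean_morphism_id C.inverse_semigroup_axioms)
    have "restrict (f \<circ> g) (carrier C) = \<gamma>"
      by (rule u[rule_format]) (use 1 f(2) g(2) \<kappa>c in simp)
    moreover have "restrict id (carrier C) = \<gamma>"
      by (rule u[rule_format]) (use 2 \<kappa>c in simp)
    ultimately show ?thesis by simp
  qed
  have hf: "f \<in> hom B C" and hg: "g \<in> hom C B"
    using f g by (auto simp: boolean_morphism_def zero_hom_def)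
  have "bij_betw f (carrier B) (carrier C)"
  proof (rule bij_betw_byWitness[of _ g])
    show "\<forall>a\<in>carrier B. g (f a) = a" using fun_cong[OF gf] by (metis comp_apply id_apply restrict_apply')
    show "\<forall>a\<in>carrier C. f (g a) = a" using fun_cong[OF fg] by (metis comp_apply id_apply restrict_apply')
    show "f ` carrier B \<subseteq> carrier C" "g ` carrier C \<subseteq> carrier B"
      using hom_in_carrier[OF hf] hom_in_carrier[OF hg] by auto
  qed
  then show ?thesis using hf by (intro is_isoI isoI)
qed

lemma is_zero_adjoin_zero: "\<not> has_zero S \<Longrightarrow> is_zero (adjoin_zero S) z \<longleftrightarrow> z = None"
proof -
  have "is_zero (adjoin_zero S) None" by (auto simp: is_zero_def adjoin_zero_def split: option.splits)
  then show ?thesis using is_zero_unique by metis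
qed

text \<open>As \<open>S\<close> itself may lack a zero, the extension property of \<open>principal_bisection\<close> is used
  for \<open>S\<close> in both cases; a homomorphism on \<open>S\<^sup>0\<close> is one on \<open>S\<close>, and the adjoined zero goes to the
  empty bisection.\<close>

definition universal_map :: "('a, 'm) monoid_scheme \<Rightarrow> 'a option \<Rightarrow> 'a set" where
  "universal_map S x = (case x of None \<Rightarrow> {} | Some s \<Rightarrow> principal_bisection S s)"

lemma is_booleanization_K:
  assumes S: "inverse_semigroup S" and fin: "finite (carrier S)"
  shows "is_booleanization TYPE('t) S (K (restricted_groupoid S)) (universal_map S)"
proof -
  interpret S: inverse_semigroup S by (rule S)
  let ?K = "K (restricted_groupoid S)"
  note K = S.RG.boolean_inverse_semigroup_K
  have ext: "\<exists>!\<gamma>. \<gamma> \<in> extensional (carrier ?K) \<and> \<gamma> \<in> boolean_morphism ?K T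
      \<and> (\<forall>s\<in>carrier S. \<gamma> (principal_bisection S s) = \<alpha> s)"
    if "boolean_inverse_semigroup T" "\<alpha> \<in> zero_hom S T" for T :: "'t monoid" and \<alpha>
  proof -
    interpret T: boolean_inverse_semigroup T by (rule that)
    interpret finite_representation S T \<alpha>
      using fin that by unfold_locales
    show ?thesis by (rule unique_extension)
  qed
  show ?thesis
  proof (cases "has_zero S")
    case True
    then show ?thesis
      using K ext S.principal_bisection_hom
      unfolding is_booleanization_def is_booleanization_with_zero_def universal_map_def by simp
  next
    case False
    let ?S = "adjoin_zero S"
    have c: "carrier ?S = insert None (Some ` carrier S)" by (simp add: adjoin_zero_def)
    have "universal_map S \<in> zero_hom ?S ?K"
    proof -
      have "universal_map S \<in> hom ?S ?K"
        by (auto simp: hom_def universal_map_def adjoin_zero_def S.RG.mult_K S.principal_bisection_bisection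
            S.principal_bisection_mult local_bisection_def[of _ "{}"])
      then show ?thesis
        by (auto simp: zero_hom_def is_zero_adjoin_zero[OF False] universal_map_def S.RG.is_zero_K_iff)
    qed
    moreover have "\<exists>!\<gamma>. \<gamma> \<in> extensional (carrier ?K) \<and> \<gamma> \<in> boolean_morphism ?K T
        \<and> (\<forall>s\<in>carrier ?S. \<gamma> (universal_map S s) = \<alpha> s)"
      if T: "boolean_inverse_semigroup T" and \<alpha>: "\<alpha> \<in> zero_hom ?S T" for T :: "'t monoid" and \<alpha>
    proof -
      have hom: "\<alpha> \<in> hom ?S T" using \<alpha> by (simp add: zero_hom_def)
      have "\<alpha> \<circ> Some \<in> hom S T"
      proof (rule homI)
        fix a b assume ab: "a \<in> carrier S" "b \<in> carrier S"
        show "(\<alpha> \<circ> Some) a \<in> carrier T" using hom_in_carrier[OF hom, of "Some a"] ab by (simp add: c)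
        have "Some a \<otimes>\<^bsub>?S\<^esub> Some b = Some (a \<otimes>\<^bsub>S\<^esub> b)" by (simp add: adjoin_zero_def)
        then show "(\<alpha> \<circ> Some) (a \<otimes>\<^bsub>S\<^esub> b) = (\<alpha> \<circ> Some) a \<otimes>\<^bsub>T\<^esub> (\<alpha> \<circ> Some) b"
          using hom_mult[OF hom, of "Some a" "Some b"] ab by (simp add: c)
      qed
      moreover have "\<not> is_zero S z" for z using False by (auto simp: has_zero_def)
      ultimately have "\<alpha> \<circ> Some \<in> zero_hom S T" by (simp add: zero_hom_def)
      note e = ext[OF T this]
      have "(\<forall>s\<in>carrier ?S. \<gamma> (universal_map S s) = \<alpha> s)
          \<longleftrightarrow> (\<forall>s\<in>carrier S. \<gamma> (principal_bisection S s) = (\<alpha> \<circ> Some) s)"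
        if "\<gamma> \<in> boolean_morphism ?K T" for \<gamma>
      proof -
        have "is_zero T (\<gamma> {})" "is_zero T (\<alpha> None)"
          using that \<alpha> by (auto simp: boolean_morphism_def zero_hom_def S.RG.is_zero_K_iff
              is_zero_adjoin_zero[OF False])
        then have "\<gamma> {} = \<alpha> None" by (rule is_zero_unique)
        then show ?thesis by (simp add: c universal_map_def)
      qed
      then show ?thesis using e by (auto 0 0 cong: conj_cong)
    qed
    ultimately show ?thesis
      using K False unfolding is_booleanization_def is_booleanization_with_zero_def by simp
  qed
qed

theorem theorem4p11:
  fixes S :: "'a monoid"
  assumes "inverse_semigroup S" and "finite (carrier S)"
  shows "boolean_inverse_semigroup (K (restricted_groupoid S))
    \<and> monoid (K (restricted_groupoid S))
    \<and> (\<exists>\<beta>. is_booleanization TYPE('a set) S (K (restricted_groupoid S)) \<beta>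
          \<and> is_booleanization TYPE('t) S (K (restricted_groupoid S)) \<beta>)
    \<and> (\<forall>(B :: 'b monoid) \<beta>.
          is_booleanization TYPE('a set) S B \<beta> \<and> is_booleanization TYPE('b) S B \<beta>
          \<longrightarrow> B \<cong> K (restricted_groupoid S))"
proof (intro conjI allI impI exI)
  interpret S: inverse_semigroup S by (rule assms)
  show "boolean_inverse_semigroup (K (restricted_groupoid S))"
    by (rule S.RG.boolean_inverse_semigroup_K)
  show "monoid (K (restricted_groupoid S))" by (rule S.RG.monoid_K)
  note K = is_booleanization_K[OF assms]
  show "is_booleanization TYPE('a set) S (K (restricted_groupoid S)) (universal_map S)"
    "is_booleanization TYPE('t) S (K (restricted_groupoid S)) (universal_map S)"
    by (rule K)+
  fix B :: "'b monoid" and \<beta>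
  assume "is_booleanization TYPE('a set) S B \<beta> \<and> is_booleanization TYPE('b) S B \<beta>"
  moreover have "is_booleanization TYPE('b) S (K (restricted_groupoid S)) (universal_map S)"
    "is_booleanization TYPE('a set) S (K (restricted_groupoid S)) (universal_map S)" by (rule K)+
  ultimately show "B \<cong> K (restricted_groupoid S)"
    unfolding is_booleanization_def
    by (cases "has_zero S") (auto intro: booleanization_with_zero_unique)
qed

end
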